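(* Let $\kappa,\kappa'\ge1$, $n=\kappa+\kappa'$, and $(\epsilon_1,\ldots,\epsilon_n)=(1^\kappa,0^{\kappa'})$ ($\kappa$ ones followed by $\kappa'$ zeros). The $\mathcal U_B(1^\kappa,0^{\kappa'})$-module $\mathcal W\otimes\mathcal W$ (with action $(\pi_x\otimes\pi_y)\Delta$) is irreducible.
   Context: $q^{1/2},x,y$ are generic (algebraically independent indeterminates over $\mathbb C$), vector spaces are over $\mathbb C(q^{1/2},x,y)$; $[m]=\frac{q^m-q^{-m}}{q-q^{-1}}$; $p=\mathrm i q^{-1/2}$, $\mathrm i=\sqrt{-1}$. $F$ has basis $|m\rangle$, $m\in\mathbb Z_{\ge0}$; $V$ has basis $|0\rangle,|1\rangle$; $\mathcal W=V^{\otimes\kappa}\otimes F^{\otimes\kappa'}$ has basis $|\mathbf m\rangle=|m_1,\ldots,m_n\rangle$ ($m_i\in\{0,1\}$ for $i\le\kappa$, $m_i\in\mathbb Z_{\ge0}$ for $i>\kappa$). $\mathbf e_i$ is the $i$th standard basis vector of $\mathbb Z^n$. $\mathcal U_B(\epsilon_1,\ldots,\epsilon_n)$: put $q_i=q$ if $\epsilon_i=0$ and $q_i=-q^{-1}$ if $\epsilon_i=1$; $\langle i\rangle=\{i,i+1\}\cap[1,n]$, $D_{i,j}=\prod_{k\in\langle i\rangle\cap\langle j\rangle}q_k^{2\delta_{i,j}-1}$; $r_0=r_n=p$, $r_i=q$ for $0<i<n$. Generators $e_i,f_i,k_i^{\pm1}$ ($0\le i\le n$), relations $k_ik_i^{-1}=k_i^{-1}k_i=1$,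 $[k_i,k_j]=0$, $k_ie_j=D_{i,j}e_jk_i$, $k_if_j=D_{i,j}^{-1}f_jk_i$, $[e_i,f_j]=\delta_{i,j}\frac{k_i-k_i^{-1}}{r_i-r_i^{-1}}$; coproduct $\Delta k_i^{\pm1}=k_i^{\pm1}\otimes k_i^{\pm1}$, $\Delta e_i=1\otimes e_i+e_i\otimes k_i$, $\Delta f_i=f_i\otimes1+k_i^{-1}\otimes f_i$. Representation $\pi_x$ on $\mathcal W$ (vectors with indices out of range are zero): $e_0|\mathbf m\rangle=x|\mathbf m+\mathbf e_1\rangle$, $f_0|\mathbf m\rangle=x^{-1}[m_1]|\mathbf m-\mathbf e_1\rangle$, $k_0|\mathbf m\rangle=p^{-1}q_1^{m_1}|\mathbf m\rangle$; for $0<i<n$: $e_i|\mathbf m\rangle=[m_i]|\mathbf m-\mathbf e_i+\mathbf e_{i+1}\rangle$, $f_i|\mathbf m\rangle=[m_{i+1}]|\mathbf m+\mathbf e_i-\mathbf e_{i+1}\rangle$, $k_i|\mathbf m\rangle=q_i^{-m_i}q_{i+1}^{m_{i+1}}|\mathbf m\rangle$; $e_n|\mathbf m\rangle=[m_n]|\mathbf m-\mathbf e_n\rangle$, $f_n|\mathbf m\rangle=|\mathbf m+\mathbf e_n\rangle$, $k_n|\mathbf m\rangle=p\,q_n^{-m_n}|\mathbf m\rangle$. *)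

theory Defs
  imports
    Complex_Main
    "HOL-Computational_Algebra.Polynomial"
    "HOL-Computational_Algebra.Fraction_Field"
    "HOL-Library.Poly_Mapping"
    "HOL-Library.Function_Algebras"
    "HOL-Library.Product_Plus"
    "HOL-Algebra.QuotRing"
begin

section \<open>The ground field\<close>

text \<open>
  The field \<open>\<complex>(q\<^sup>1\<^sup>/\<^sup>2, x, y)\<close> is the fraction field of the polynomial ring
  \<open>\<complex>[q\<^sup>1\<^sup>/\<^sup>2][x][y]\<close>; \<open>qh\<close> stands for the indeterminate \<open>q\<^sup>1\<^sup>/\<^sup>2\<close>.
\<close>

type_synonym scalar = "complex poly poly poly fract"

definition imag :: scalar where "imag = Fract [:[:[:\<i>:]:]:] 1"
definition qh :: scalar where "qh = Fract [:[:[:0, 1:]:]:] 1"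
definition xvar :: scalar where "xvar = Fract [:[:0, 1:]:] 1"
definition yvar :: scalar where "yvar = Fract [:0, 1:] 1"

definition qpar :: scalar where "qpar = qh ^ 2"
definition ppar :: scalar where "ppar = imag * inverse qh"

definition qnum :: "int \<Rightarrow> scalar" where
  "qnum m = (qpar powi m - qpar powi (- m)) / (qpar - inverse qpar)"


section \<open>Free vector spaces\<close>

text \<open>
  \<open>'a \<Rightarrow>\<^sub>0 scalar\<close> is the vector space with basis \<open>'a\<close>, and the tensor product of the spaces
  with bases \<open>'a\<close> and \<open>'b\<close> is the space with basis \<open>'a \<times> 'b\<close>.
\<close>

definition smul :: "scalar \<Rightarrow> ('a \<Rightarrow>\<^sub>0 scalar) \<Rightarrow> ('a \<Rightarrow>\<^sub>0 scalar)" where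
  "smul c v = Poly_Mapping.map ((*) c) v"

definition lin_ext :: "('a \<Rightarrow> ('b \<Rightarrow>\<^sub>0 scalar)) \<Rightarrow> ('a \<Rightarrow>\<^sub>0 scalar) \<Rightarrow> ('b \<Rightarrow>\<^sub>0 scalar)" where
  "lin_ext f v = (\<Sum>a\<in>Poly_Mapping.keys v. smul (Poly_Mapping.lookup v a) (f a))"

definition tens ::
    "('a \<Rightarrow>\<^sub>0 scalar) \<Rightarrow> ('b \<Rightarrow>\<^sub>0 scalar) \<Rightarrow> ('a \<times> 'b \<Rightarrow>\<^sub>0 scalar)" where
  "tens u v = (\<Sum>a\<in>Poly_Mapping.keys u. \<Sum>b\<in>Poly_Mapping.keys v.
     Poly_Mapping.single (a, b) (Poly_Mapping.lookup u a * Poly_Mapping.lookup v b))"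

definition tens_op ::
    "(('a \<Rightarrow>\<^sub>0 scalar) \<Rightarrow> ('a \<Rightarrow>\<^sub>0 scalar)) \<Rightarrow> (('b \<Rightarrow>\<^sub>0 scalar) \<Rightarrow> ('b \<Rightarrow>\<^sub>0 scalar)) \<Rightarrow>
     ('a \<times> 'b \<Rightarrow>\<^sub>0 scalar) \<Rightarrow> ('a \<times> 'b \<Rightarrow>\<^sub>0 scalar)" where
  "tens_op A B = lin_ext
     (\<lambda>(a, b). tens (A (Poly_Mapping.single a 1)) (B (Poly_Mapping.single b 1)))"


section \<open>The free algebra on the generators\<close>

datatype gen = gen_e nat | gen_f nat | gen_k nat | gen_kinv nat

primrec gen_index :: "gen \<Rightarrow> nat" where
  "gen_index (gen_e i) = i"
| "gen_index (gen_f i) = i"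
| "gen_index (gen_k i) = i"
| "gen_index (gen_kinv i) = i"

text \<open>
  Words form the free monoid, written additively so that the convolution product of
  \<open>\<Rightarrow>\<^sub>0\<close> makes \<open>gword \<Rightarrow>\<^sub>0 scalar\<close> the free associative algebra, and
  \<open>gword \<times> gword \<Rightarrow>\<^sub>0 scalar\<close> its tensor square with the componentwise product.
\<close>

datatype gword = Word (letters: "gen list")

instantiation gword :: monoid_add
begin

definition zero_gword :: gword where "0 = Word []"

definition plus_gword :: "gword \<Rightarrow> gword \<Rightarrow> gword" where
  "v + w = Word (letters v @ letters w)"

instance by standard (simp_all add: zero_gword_def plus_gword_def)

end

type_synonym free_alg = "gword \<Rightarrow>\<^sub>0 scalar"

definition gvar :: "gen \<Rightarrow> free_alg" where
  "gvar g = Poly_Mapping.single (Word [g]) 1"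

abbreviation "ge i \<equiv> gvar (gen_e i)"
abbreviation "gf i \<equiv> gvar (gen_f i)"
abbreviation "gk i \<equiv> gvar (gen_k i)"
abbreviation "gkinv i \<equiv> gvar (gen_kinv i)"

definition free_ring :: "nat \<Rightarrow> free_alg ring" where
  "free_ring n = \<lparr>
     carrier = {a. \<forall>w\<in>Poly_Mapping.keys a. \<forall>g\<in>set (letters w). gen_index g \<le> n},
     monoid.mult = (*), one = 1, ring.zero = 0, add = (+)\<rparr>"


section \<open>The algebra \<open>U\<^sub>B(\<epsilon>\<^sub>1,\<dots>,\<epsilon>\<^sub>n)\<close>\<close>

definition qi :: "(nat \<Rightarrow> nat) \<Rightarrow> nat \<Rightarrow> scalar" where
  "qi \<epsilon> i = (if \<epsilon> i = 0 then qpar else - inverse qpar)"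

definition nbr :: "nat \<Rightarrow> nat \<Rightarrow> nat set" where
  "nbr n i = {i, i + 1} \<inter> {1..n}"

definition Dcoef :: "nat \<Rightarrow> (nat \<Rightarrow> nat) \<Rightarrow> nat \<Rightarrow> nat \<Rightarrow> scalar" where
  "Dcoef n \<epsilon> i j = (\<Prod>l\<in>nbr n i \<inter> nbr n j. qi \<epsilon> l powi (2 * of_bool (i = j) - 1))"

definition ri :: "nat \<Rightarrow> nat \<Rightarrow> scalar" where
  "ri n i = (if i = 0 \<or> i = n then ppar else qpar)"

definition UB_rels :: "nat \<Rightarrow> (nat \<Rightarrow> nat) \<Rightarrow> free_alg set" where
  "UB_rels n \<epsilon> =
     {gk i * gkinv i - 1 | i. i \<le> n}
   \<union> {gkinv i * gk i - 1 | i. i \<le> n}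
   \<union> {gk i * gk j - gk j * gk i | i j. i \<le> n \<and> j \<le> n}
   \<union> {gk i * ge j - smul (Dcoef n \<epsilon> i j) (ge j * gk i) | i j. i \<le> n \<and> j \<le> n}
   \<union> {gk i * gf j - smul (inverse (Dcoef n \<epsilon> i j)) (gf j * gk i) | i j. i \<le> n \<and> j \<le> n}
   \<union> {ge i * gf j - gf j * ge i
        - smul (of_bool (i = j) / (ri n i - inverse (ri n i))) (gk i - gkinv i)
       | i j. i \<le> n \<and> j \<le> n}"

definition UB :: "nat \<Rightarrow> (nat \<Rightarrow> nat) \<Rightarrow> free_alg set ring" where
  "UB n \<epsilon> = free_ring n Quot (genideal (free_ring n) (UB_rels n \<epsilon>))"

text \<open>The coproduct, as the algebra homomorphism from the free algebra to its tensor square.\<close>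

primrec coprod_gen :: "gen \<Rightarrow> (gword \<times> gword \<Rightarrow>\<^sub>0 scalar)" where
  "coprod_gen (gen_e i) = tens 1 (ge i) + tens (ge i) (gk i)"
| "coprod_gen (gen_f i) = tens (gf i) 1 + tens (gkinv i) (gf i)"
| "coprod_gen (gen_k i) = tens (gk i) (gk i)"
| "coprod_gen (gen_kinv i) = tens (gkinv i) (gkinv i)"

definition coprod :: "free_alg \<Rightarrow> (gword \<times> gword \<Rightarrow>\<^sub>0 scalar)" where
  "coprod = lin_ext (\<lambda>w. prod_list (List.map coprod_gen (letters w)))"


section \<open>The representation \<open>\<pi>\<^sub>z\<close> on \<open>W\<close>\<close>

text \<open>
  A label \<open>m = (m\<^sub>1,\<dots>,m\<^sub>n)\<close> is an integer-valued function vanishing outside \<open>{1..n}\<close>.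
\<close>

type_synonym label = "nat \<Rightarrow> int"

definition labels :: "nat \<Rightarrow> nat \<Rightarrow> label set" where
  "labels \<kappa> \<kappa>' = {m. (\<forall>i\<in>{1..\<kappa>}. m i \<in> {0, 1})
                   \<and> (\<forall>i\<in>{\<kappa> + 1..\<kappa> + \<kappa>'}. m i \<ge> 0)
                   \<and> (\<forall>i. i \<notin> {1..\<kappa> + \<kappa>'} \<longrightarrow> m i = 0)}"

definition ket :: "nat \<Rightarrow> nat \<Rightarrow> label \<Rightarrow> (label \<Rightarrow>\<^sub>0 scalar)" where
  "ket \<kappa> \<kappa>' m = (if m \<in> labels \<kappa> \<kappa>' then Poly_Mapping.single m 1 else 0)"

definition ee :: "nat \<Rightarrow> label" where
  "ee i = (\<lambda>j. of_bool (j = i))"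

definition eps :: "nat \<Rightarrow> nat \<Rightarrow> nat" where
  "eps \<kappa> i = (if i \<le> \<kappa> then 1 else 0)"

definition kval :: "nat \<Rightarrow> nat \<Rightarrow> nat \<Rightarrow> label \<Rightarrow> scalar" where
  "kval \<kappa> \<kappa>' i m =
     (if i = 0 then inverse ppar * qi (eps \<kappa>) 1 powi m 1
      else if i < \<kappa> + \<kappa>' then qi (eps \<kappa>) i powi (- m i) * qi (eps \<kappa>) (i + 1) powi m (i + 1)
      else ppar * qi (eps \<kappa>) i powi (- m i))"

primrec rep_ket :: "nat \<Rightarrow> nat \<Rightarrow> scalar \<Rightarrow> gen \<Rightarrow> label \<Rightarrow> (label \<Rightarrow>\<^sub>0 scalar)" where
  "rep_ket \<kappa> \<kappa>' z (gen_e i) m =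
     (if i = 0 then smul z (ket \<kappa> \<kappa>' (m + ee 1))
      else if i < \<kappa> + \<kappa>' then smul (qnum (m i)) (ket \<kappa> \<kappa>' (m - ee i + ee (i + 1)))
      else smul (qnum (m i)) (ket \<kappa> \<kappa>' (m - ee i)))"
| "rep_ket \<kappa> \<kappa>' z (gen_f i) m =
     (if i = 0 then smul (inverse z * qnum (m 1)) (ket \<kappa> \<kappa>' (m - ee 1))
      else if i < \<kappa> + \<kappa>' then smul (qnum (m (i + 1))) (ket \<kappa> \<kappa>' (m + ee i - ee (i + 1)))
      else ket \<kappa> \<kappa>' (m + ee i))"
| "rep_ket \<kappa> \<kappa>' z (gen_k i) m = smul (kval \<kappa> \<kappa>' i m) (ket \<kappa> \<kappa>' m)"
| "rep_ket \<kappa> \<kappa>' z (gen_kinv i) m = smul (inverse (kval \<kappa> \<kappa>' i m)) (ket \<kappa> \<kappa>' m)"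

definition rep_word ::
    "nat \<Rightarrow> nat \<Rightarrow> scalar \<Rightarrow> gword \<Rightarrow> (label \<Rightarrow>\<^sub>0 scalar) \<Rightarrow> (label \<Rightarrow>\<^sub>0 scalar)" where
  "rep_word \<kappa> \<kappa>' z w = foldr (\<lambda>g. lin_ext (rep_ket \<kappa> \<kappa>' z g)) (letters w)"


section \<open>The module \<open>W \<otimes> W\<close>\<close>

definition WW :: "nat \<Rightarrow> nat \<Rightarrow> (label \<times> label \<Rightarrow>\<^sub>0 scalar) set" where
  "WW \<kappa> \<kappa>' = {v. Poly_Mapping.keys v \<subseteq> labels \<kappa> \<kappa>' \<times> labels \<kappa> \<kappa>'}"

definition rep2 ::
    "nat \<Rightarrow> nat \<Rightarrow> (gword \<times> gword \<Rightarrow>\<^sub>0 scalar) \<Rightarrow>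
     (label \<times> label \<Rightarrow>\<^sub>0 scalar) \<Rightarrow> (label \<times> label \<Rightarrow>\<^sub>0 scalar)" where
  "rep2 \<kappa> \<kappa>' t v =
     lin_ext (\<lambda>(w, w'). tens_op (rep_word \<kappa> \<kappa>' xvar w) (rep_word \<kappa> \<kappa>' yvar w') v) t"

text \<open>
  The elements of \<open>UB\<close> are cosets \<open>u\<close> of the ideal of relations. The action is evaluated on
  representatives; \<open>the_elem\<close> is meaningful because \<open>(\<pi>\<^sub>x \<otimes> \<pi>\<^sub>y) \<circ> \<Delta>\<close> kills that ideal on
  \<open>W \<otimes> W\<close>. No such compatibility is presupposed: the module laws in \<open>irreducible_module\<close>
  below have to be proved for this action.
\<close>

definition WW_action ::
    "nat \<Rightarrow> nat \<Rightarrow> free_alg set \<Rightarrow>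
     (label \<times> label \<Rightarrow>\<^sub>0 scalar) \<Rightarrow> (label \<times> label \<Rightarrow>\<^sub>0 scalar)" where
  "WW_action \<kappa> \<kappa>' u v = the_elem ((\<lambda>a. rep2 \<kappa> \<kappa>' (coprod a) v) ` u)"


section \<open>Irreducible modules\<close>

text \<open>
  The locale \<open>module\<close> of HOL-Algebra is restricted to commutative rings, hence this
  version for unital left modules over an arbitrary ring. Since \<open>UB\<close> contains the scalars, its
  submodules are automatically linear subspaces.
\<close>

definition left_module ::
    "('r, 's) ring_scheme \<Rightarrow> ('v::ab_group_add) set \<Rightarrow> ('r \<Rightarrow> 'v \<Rightarrow> 'v) \<Rightarrow> bool" where
  "left_module R M act \<longleftrightarrow>
     ring R
   \<and> 0 \<in> M \<and> (\<forall>v\<in>M. \<forall>w\<in>M. v + w \<in> M) \<and> (\<forall>v\<in>M. - v \<in> M)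
   \<and> (\<forall>a\<in>carrier R. \<forall>v\<in>M. act a v \<in> M)
   \<and> (\<forall>a\<in>carrier R. \<forall>v\<in>M. \<forall>w\<in>M. act a (v + w) = act a v + act a w)
   \<and> (\<forall>a\<in>carrier R. \<forall>b\<in>carrier R. \<forall>v\<in>M. act (a \<oplus>\<^bsub>R\<^esub> b) v = act a v + act b v)
   \<and> (\<forall>a\<in>carrier R. \<forall>b\<in>carrier R. \<forall>v\<in>M. act (a \<otimes>\<^bsub>R\<^esub> b) v = act a (act b v))
   \<and> (\<forall>v\<in>M. act \<one>\<^bsub>R\<^esub> v = v)"

definition left_submodule ::
    "('r, 's) ring_scheme \<Rightarrow> ('v::ab_group_add) set \<Rightarrow> ('r \<Rightarrow> 'v \<Rightarrow> 'v) \<Rightarrow> 'v set \<Rightarrow> bool" where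
  "left_submodule R M act N \<longleftrightarrow>
     N \<subseteq> M \<and> 0 \<in> N \<and> (\<forall>v\<in>N. \<forall>w\<in>N. v + w \<in> N) \<and> (\<forall>v\<in>N. - v \<in> N)
   \<and> (\<forall>a\<in>carrier R. \<forall>v\<in>N. act a v \<in> N)"

definition irreducible_module ::
    "('r, 's) ring_scheme \<Rightarrow> ('v::ab_group_add) set \<Rightarrow> ('r \<Rightarrow> 'v \<Rightarrow> 'v) \<Rightarrow> bool" where
  "irreducible_module R M act \<longleftrightarrow>
     left_module R M act \<and> M \<noteq> {0}
   \<and> (\<forall>N. left_submodule R M act N \<longrightarrow> N = {0} \<or> N = M)"

end

theory Submission
  imports Defs
begin

text \<open>
  Why the theorem holds. A label is a configuration of particles on the sites \<open>1,...,n\<close>; the first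
  \<open>\<kappa>\<close> sites hold at most one particle each. The generator \<open>f_n\<close> creates a particle at site \<open>n\<close>,
  \<open>f_i\<close> with \<open>0 < i < n\<close> moves one from \<open>i + 1\<close> to \<open>i\<close>, \<open>f_0\<close> removes one at site \<open>1\<close>, and the \<open>e_i\<close> do
  the opposite. The label of the vacuum is \<open>0\<close>.
  
  The action is well defined because the relations hold on one tensor factor, where they compare
  coefficients of single basis vectors (\<open>act_k_ef\<close>, \<open>act_ef\<close>), and because the
  coproduct is compatible with them (\<open>UB_rels_annihilate\<close>).
  
  Let \<open>N\<close> be a nonzero submodule. The generators \<open>e_1,...,e_n\<close> lower a height function, so applying
  them leads to a nonzero \<open>v\<close> in \<open>N\<close> that all of them kill. The equation \<open>e_i v = 0\<close> ties the
  coefficient of \<open>v\<close> at \<open>(m, m')\<close> to the one at a pair where the left factor has been lowered and the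
  right factor raised; following it, the whole of \<open>m\<close> is carried over to the right factor, and then
  the same equations show that only site \<open>n\<close> is occupied (\<open>singular_keys\<close>). On vectors supported at
  site \<open>n\<close> the word \<open>f_0 f_1 ... f_(n-1)\<close>, which takes a particle from site \<open>n\<close> through the whole chain
  and out at its other end, is a second annihilation operator besides \<open>e_n\<close>. It picks up \<open>1/x\<close> on the
  left and \<open>1/y\<close> on the right factor, and \<open>e_n\<close> does not; so the two are independent, by a \<open>2 \<times> 2\<close>
  determinant that vanishes only if \<open>x + y q^l = 0\<close>, and they have no common kernel except the vacuum
  (\<open>lowering_kernel\<close>). Hence \<open>N\<close> contains the vacuum (\<open>vacuum_in_submodule\<close>).
  
  Conversely the vacuum generates everything. The creation operators \<open>f_n\<close> and \<open>e_(n-1) ... e_0\<close> at site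
  \<open>n\<close> are independent by a similar determinant, so they reach all vectors supported at site \<open>n\<close>
  (\<open>last_site_in_submodule\<close>). Modulo vectors obtained by applying \<open>f_1,...,f_n\<close> to already known ones, a particle
  can be passed from the left factor to the right one, until the left factor is the vacuum; there
  \<open>f_i\<close> with \<open>i < n\<close> acts on the right factor alone and builds all remaining vectors from those
  supported at site \<open>n\<close> (\<open>all_in_submodule\<close>).
\<close>
section \<open>Linear algebra\<close>

lemma lookup_smul [simp]: "Poly_Mapping.lookup (smul c v) k = c * Poly_Mapping.lookup v k"
  by (simp add: smul_def Poly_Mapping.map.rep_eq when_def)

global_interpretation pm: Modules.module smul
  by unfold_locales (auto intro!: poly_mapping_eqI simp: lookup_add algebra_simps)

abbreviation linmap :: "(('a \<Rightarrow>\<^sub>0 scalar) \<Rightarrow> ('b \<Rightarrow>\<^sub>0 scalar)) \<Rightarrow> bool" where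
  "linmap \<equiv> module_hom smul smul"

abbreviation bas :: "'a \<Rightarrow> ('a \<Rightarrow>\<^sub>0 scalar)" where
  "bas a \<equiv> Poly_Mapping.single a 1"

lemma linmapI:
  assumes "\<And>u v. T (u + v) = T u + T v" "\<And>c v. T (smul c v) = smul c (T v)"
  shows "linmap T"
  using assms by (simp add: module_hom_iff pm.module_axioms)

lemmas linmap_simps = module_hom.add module_hom.scale module_hom.diff module_hom.neg module_hom.zero module_hom.sum

lemma smul_single [simp]: "smul c (Poly_Mapping.single a d) = Poly_Mapping.single a (c * d)"
  by (auto intro!: poly_mapping_eqI simp: lookup_single when_def)

lemma single_eq_smul_bas: "Poly_Mapping.single a d = smul d (bas a)"
  by simp

lemma bas_expansion:
  "v = (\<Sum>a\<in>Poly_Mapping.keys v. smul (Poly_Mapping.lookup v a) (bas a))"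
proof (rule poly_mapping_eqI)
  fix k
  have "(\<Sum>a\<in>Poly_Mapping.keys v. Poly_Mapping.lookup (smul (Poly_Mapping.lookup v a) (bas a)) k)
      = (\<Sum>a\<in>Poly_Mapping.keys v. if a = k then Poly_Mapping.lookup v a else 0)"
    by (intro sum.cong) (auto simp: lookup_single when_def)
  also have "\<dots> = Poly_Mapping.lookup v k"
    by (simp add: in_keys_iff)
  finally show "Poly_Mapping.lookup v k =
      Poly_Mapping.lookup (\<Sum>a\<in>Poly_Mapping.keys v. smul (Poly_Mapping.lookup v a) (bas a)) k"
    by (simp add: lookup_sum)
qed

text \<open>
  The principle by which identities between operators are reduced to basis vectors. Only the
  basis vectors that occur in \<open>v\<close> matter, since the relations hold on labels only.
\<close>
lemma linmap_eqI_on: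
  assumes "linmap S" "linmap T" "\<And>a. a \<in> Poly_Mapping.keys v \<Longrightarrow> S (bas a) = T (bas a)"
  shows "S v = T v"
proof -
  have "S v = (\<Sum>a\<in>Poly_Mapping.keys v. smul (Poly_Mapping.lookup v a) (S (bas a)))"
    by (subst bas_expansion) (simp only: linmap_simps[OF assms(1)])
  also have "\<dots> = (\<Sum>a\<in>Poly_Mapping.keys v. smul (Poly_Mapping.lookup v a) (T (bas a)))"
    using assms(3) by (intro sum.cong) auto
  also have "\<dots> = T v"
    by (subst (3) bas_expansion) (simp only: linmap_simps[OF assms(2)])
  finally show ?thesis .
qed

lemma linmap_eqI: "linmap S \<Longrightarrow> linmap T \<Longrightarrow> (\<And>a. S (bas a) = T (bas a)) \<Longrightarrow> S = T"
  by (rule ext) (rule linmap_eqI_on)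

lemma lin_ext_superset:
  assumes "finite S" "Poly_Mapping.keys v \<subseteq> S"
  shows "lin_ext f v = (\<Sum>a\<in>S. smul (Poly_Mapping.lookup v a) (f a))"
  unfolding lin_ext_def using assms
  by (intro sum.mono_neutral_left) (auto simp: in_keys_iff)

lemma keys_smul_subset: "Poly_Mapping.keys (smul c v) \<subseteq> Poly_Mapping.keys v"
  by (auto simp: in_keys_iff)

lemma linmap_lin_ext: "linmap (lin_ext f)"
proof (rule linmapI)
  fix u v :: "'a \<Rightarrow>\<^sub>0 scalar"
  let ?S = "Poly_Mapping.keys u \<union> Poly_Mapping.keys v"
  show "lin_ext f (u + v) = lin_ext f u + lin_ext f v"
    by (subst (1 2 3) lin_ext_superset[of ?S])
       (use keys_add[of u v] in \<open>auto simp: lookup_add pm.scale_left_distrib sum.distrib\<close>)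
next
  fix c and v :: "'a \<Rightarrow>\<^sub>0 scalar"
  show "lin_ext f (smul c v) = smul c (lin_ext f v)"
    by (subst (1 2) lin_ext_superset[of "Poly_Mapping.keys v"])
       (simp_all add: keys_smul_subset pm.scale_sum_right)
qed

lemma lin_ext_bas [simp]: "lin_ext f (bas a) = f a"
  by (simp add: lin_ext_def)

lemmas lin_ext_simps = linmap_simps[OF linmap_lin_ext]

lemma lookup_lin_ext:
  "Poly_Mapping.lookup (lin_ext f v) k
     = (\<Sum>a\<in>Poly_Mapping.keys v. Poly_Mapping.lookup v a * Poly_Mapping.lookup (f a) k)"
  by (simp add: lin_ext_def lookup_sum)

lemma linmap_lin_ext_arg:
  assumes "\<And>a. linmap (f a)"
  shows "linmap (\<lambda>v. lin_ext (\<lambda>a. f a v) t)"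
  by (rule linmapI)
    (simp_all add: lin_ext_def linmap_simps[OF assms] pm.scale_right_distrib sum.distrib
      pm.scale_sum_right mult.commute)

lemma linmap_compose: "linmap S \<Longrightarrow> linmap T \<Longrightarrow> linmap (\<lambda>v. T (S v))"
  using module_hom_compose[of smul smul S smul T] by (simp add: o_def)

lemma linmap_id: "linmap id" "linmap (\<lambda>v. v)" by (auto intro: linmapI)


section \<open>Tensor products\<close>

lemma lookup_tens [simp]:
  "Poly_Mapping.lookup (tens u v) (a, b) = Poly_Mapping.lookup u a * Poly_Mapping.lookup v b"
proof -
  have "Poly_Mapping.lookup (tens u v) (a, b) =
     (\<Sum>a'\<in>Poly_Mapping.keys u. \<Sum>b'\<in>Poly_Mapping.keys v.
        if b' = b then (if a' = a then Poly_Mapping.lookup u a * Poly_Mapping.lookup v b else 0) else 0)"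
    unfolding tens_def lookup_sum
    by (intro sum.cong refl) (auto simp: lookup_single when_def)
  also have "\<dots> = (\<Sum>a'\<in>Poly_Mapping.keys u. 
       if a' = a then Poly_Mapping.lookup u a * Poly_Mapping.lookup v b else 0)"
    by (intro sum.cong refl) (auto simp: in_keys_iff)
  also have "\<dots> = Poly_Mapping.lookup u a * Poly_Mapping.lookup v b"
    by (auto simp: in_keys_iff)
  finally show ?thesis .
qed

lemma tens_eqI:
  "(\<And>a b. Poly_Mapping.lookup u (a, b) = Poly_Mapping.lookup v (a, b)) \<Longrightarrow> u = v"
  by (rule poly_mapping_eqI) auto

lemma tens_add_left: "tens (u + u') v = tens u v + tens u' v"
  and tens_add_right: "tens u (v + v') = tens u v + tens u v'"
  and tens_diff_left: "tens (u - u') v = tens u v - tens u' v"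
  and tens_diff_right: "tens u (v - v') = tens u v - tens u v'"
  and tens_smul_left: "tens (smul c u) v = smul c (tens u v)"
  and tens_smul_right: "tens u (smul c v) = smul c (tens u v)"
  and tens_zero_left [simp]: "tens 0 v = 0"
  and tens_zero_right [simp]: "tens u 0 = 0"
  and tens_bas [simp]: "tens (bas a) (bas b) = bas (a, b)"
  by (rule tens_eqI; simp add: lookup_add lookup_minus lookup_single when_def algebra_simps)+

lemmas tens_bilinear = tens_add_left tens_add_right tens_diff_left tens_diff_right
  tens_smul_left tens_smul_right

lemma linmap_tens_op: "linmap (tens_op A B)"
  unfolding tens_op_def by (rule linmap_lin_ext)

lemma tens_op_bas [simp]: "tens_op A B (bas (a, b)) = tens (A (bas a)) (B (bas b))"
  by (simp add: tens_op_def)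

lemma tens_op_tens:
  assumes "linmap A" "linmap B"
  shows "tens_op A B (tens u v) = tens (A u) (B v)"
proof -
  have 1: "tens_op A B (tens u (bas b)) = tens (A u) (B (bas b))" for b
    by (rule fun_cong[OF linmap_eqI, where f = "\<lambda>u. tens_op A B (tens u (bas b))"])
      (auto intro!: linmapI simp: tens_bilinear linmap_simps[OF assms(1)] linmap_simps[OF linmap_tens_op])
  show ?thesis
    by (rule fun_cong[OF linmap_eqI, where f = "\<lambda>v. tens_op A B (tens u v)"])
      (auto intro!: linmapI simp: 1 tens_bilinear linmap_simps[OF assms(2)] linmap_simps[OF linmap_tens_op])
qed

text \<open>
  The tensor square acts through this rule: composition happens in each factor separately.
\<close>
lemma tens_op_compose:
  assumes "linmap A" "linmap B"
  shows "tens_op A B (tens_op C D v) = tens_op (A \<circ> C) (B \<circ> D) v"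
  by (rule fun_cong[OF linmap_eqI, where f = "\<lambda>v. tens_op A B (tens_op C D v)"])
    (auto intro: linmap_tens_op linmap_compose simp: tens_op_tens[OF assms])

lemma tens_op_id [simp]: "tens_op id id = id"
  by (rule linmap_eqI) (auto intro: linmap_tens_op linmap_id)


section \<open>The coproduct and the action\<close>

lemma smul_eq_mult: "smul c (a :: 'a::monoid_add \<Rightarrow>\<^sub>0 scalar) = Poly_Mapping.single 0 c * a"
  by (simp add: smul_def mult_map_scale_conv_mult)

lemma linmap_mult_left: "linmap (\<lambda>a. a * (b :: 'a::monoid_add \<Rightarrow>\<^sub>0 scalar))"
  by (rule linmapI) (simp_all add: smul_eq_mult algebra_simps)

lemma single_0_commute:
  "a * Poly_Mapping.single 0 c = Poly_Mapping.single 0 c * (a :: 'a::monoid_add \<Rightarrow>\<^sub>0 scalar)"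
proof -
  have "linmap (\<lambda>a :: 'a \<Rightarrow>\<^sub>0 scalar. Poly_Mapping.single 0 c * a)"
    by (rule linmapI) (simp_all add: smul_eq_mult algebra_simps mult_single flip: mult.assoc)
  from linmap_eqI[OF linmap_mult_left this, of "Poly_Mapping.single 0 c"] show ?thesis
    by (simp add: mult_single fun_eq_iff)
qed

lemma linmap_mult_right: "linmap (\<lambda>a. (b :: 'a::monoid_add \<Rightarrow>\<^sub>0 scalar) * a)"
proof (rule linmapI)
  fix c v
  have "b * smul c v = (b * Poly_Mapping.single 0 c) * v"
    by (simp add: smul_eq_mult mult.assoc)
  thus "b * smul c v = smul c (b * v)"
    by (simp add: single_0_commute) (simp add: smul_eq_mult mult.assoc)
qed (simp add: algebra_simps)

lemma one_eq_bas: "(1 :: 'a::monoid_add \<Rightarrow>\<^sub>0 scalar) = bas 0"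
  by simp

lemma linmap_coprod: "linmap coprod"
  unfolding coprod_def by (rule linmap_lin_ext)

lemma coprod_bas [simp]: "coprod (bas w) = prod_list (map coprod_gen (letters w))"
  by (simp add: coprod_def)

text \<open>
  Both sides are bilinear, and on words the coproduct is multiplicative by construction.
\<close>
lemma coprod_mult: "coprod (a * b) = coprod a * coprod b"
proof -
  have 1: "coprod (bas w * b) = coprod (bas w) * coprod b" for w
    by (rule fun_cong[OF linmap_eqI, where f = "\<lambda>b. coprod (bas w * b)"])
      (auto intro!: linmap_compose[OF linmap_mult_right linmap_coprod]
         linmap_compose[OF linmap_coprod linmap_mult_right]
        simp: mult_single plus_gword_def)
  show ?thesis
    by (rule fun_cong[OF linmap_eqI, where f = "\<lambda>a. coprod (a * b)"])
      (auto intro!: linmap_compose[OF linmap_mult_left linmap_coprod]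
         linmap_compose[OF linmap_coprod linmap_mult_left] simp: 1)
qed

lemma coprod_one [simp]: "coprod 1 = 1"
  by (simp only: one_eq_bas coprod_bas) (simp add: zero_gword_def)

lemma coprod_gvar: "coprod (gvar g) = coprod_gen g"
  by (simp add: gvar_def)

lemma linmap_rep_word: "linmap (rep_word \<kappa> \<kappa>' z w)"
proof -
  have "linmap (foldr (\<lambda>g. lin_ext (rep_ket \<kappa> \<kappa>' z g)) gs)" for gs
    by (induction gs) (auto intro: linmap_id linmap_compose linmap_lin_ext simp: comp_def)
  thus ?thesis by (simp add: rep_word_def)
qed

lemma rep_word_plus: "rep_word \<kappa> \<kappa>' z (v + w) = rep_word \<kappa> \<kappa>' z v \<circ> rep_word \<kappa> \<kappa>' z w"
  by (simp add: rep_word_def plus_gword_def fun_eq_iff)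

lemma rep_word_zero [simp]: "rep_word \<kappa> \<kappa>' z 0 = id"
  by (simp add: rep_word_def zero_gword_def id_def)

lemma linmap_rep2_left: "linmap (\<lambda>t. rep2 \<kappa> \<kappa>' t v)"
  unfolding rep2_def by (rule linmap_lin_ext)

lemma linmap_rep2_right: "linmap (rep2 \<kappa> \<kappa>' t)"
  unfolding rep2_def by (rule linmap_lin_ext_arg) (auto intro: linmap_tens_op)

lemma rep2_bas [simp]:
  "rep2 \<kappa> \<kappa>' (bas (w, w')) v = tens_op (rep_word \<kappa> \<kappa>' xvar w) (rep_word \<kappa> \<kappa>' yvar w') v"
  by (simp add: rep2_def)

text \<open>
  Again by bilinearity: on pairs of words it is concatenation against composition in each factor.
\<close>
lemma rep2_mult: "rep2 \<kappa> \<kappa>' (s * t) v = rep2 \<kappa> \<kappa>' s (rep2 \<kappa> \<kappa>' t v)"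
proof -
  have 1: "rep2 \<kappa> \<kappa>' (bas (w, w') * t) v = rep2 \<kappa> \<kappa>' (bas (w, w')) (rep2 \<kappa> \<kappa>' t v)" for w w'
    by (rule fun_cong[OF linmap_eqI, where f = "\<lambda>t. rep2 \<kappa> \<kappa>' (bas (w, w') * t) v"])
      (auto intro!: linmap_compose[OF linmap_mult_right linmap_rep2_left] 
         linmap_compose[OF linmap_rep2_left linmap_tens_op]
        simp: mult_single rep_word_plus tens_op_compose linmap_rep_word)
  show ?thesis
    by (rule fun_cong[OF linmap_eqI, where f = "\<lambda>s. rep2 \<kappa> \<kappa>' (s * t) v"])
      (auto intro!: linmap_compose[OF linmap_mult_left linmap_rep2_left] linmap_rep2_left simp: 1)
qed

lemma rep2_one [simp]: "rep2 \<kappa> \<kappa>' 1 v = v"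
  by (simp only: one_eq_bas zero_prod_def rep2_bas) simp

section \<open>Genericity of the parameters\<close>

lemma Fract_power: "Fract (a :: 'a::idom) 1 ^ k = Fract (a ^ k) 1"
  by (induction k) (simp_all add: One_fract_def)

lemma qpar_power: "qpar ^ k = Fract [:[:[:0, 1:] ^ (2 * k):]:] 1"
proof -
  have "[:[:[:0, 1:]:]:] ^ m = ([:[:[:0, 1:] ^ m:]:] :: complex poly poly poly)" for m
    by (induction m) (simp_all add: one_pCons)
  moreover have "qpar ^ k = qh ^ (2 * k)"
    by (simp add: qpar_def power_mult)
  ultimately show ?thesis
    by (simp add: qh_def Fract_power)
qed

lemma qpar_power_neq_1: "k > 0 \<Longrightarrow> qpar ^ k \<noteq> 1"
proof
  assume "k > 0" "qpar ^ k = 1"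
  hence "[:0, 1:] ^ (2 * k) = (1 :: complex poly)"
    by (simp add: qpar_power One_fract_def eq_fract) (simp add: one_pCons)
  hence "poly ([:0, 1:] ^ (2 * k)) 0 = (1 :: complex)" by simp
  thus False using \<open>k > 0\<close> by (simp add: poly_power power_0_left)
qed

lemma qh_nonzero: "qh \<noteq> 0"
  by (simp add: qh_def Zero_fract_def eq_fract)

lemma qpar_nonzero [simp]: "qpar \<noteq> 0"
  using qh_nonzero by (simp add: qpar_def)

lemma xvar_nonzero [simp]: "xvar \<noteq> 0"
  by (simp add: xvar_def Zero_fract_def eq_fract)

lemma yvar_nonzero [simp]: "yvar \<noteq> 0"
  by (simp add: yvar_def Zero_fract_def eq_fract)

text \<open>
  The independence of \<open>x\<close> and \<open>y\<close> enters through these sums: they are the determinants, up to units,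
  of the systems that decide whether two annihilation or two creation operators at site \<open>n\<close> are
  independent.
\<close>
lemma xy_generic: "xvar + yvar * qpar ^ k \<noteq> 0" "yvar + xvar * qpar ^ k \<noteq> 0"
  by (simp_all add: xvar_def yvar_def qpar_power Zero_fract_def eq_fract)

lemma ppar_square: "ppar * ppar = - inverse qpar"
proof -
  have "imag * imag = - 1"
    by (simp add: imag_def One_fract_def eq_fract) (simp add: one_pCons)
  moreover have "ppar * ppar = (imag * imag) * inverse qpar"
    by (simp add: ppar_def qpar_def power2_eq_square)
  ultimately show ?thesis by simp
qed

lemma ppar_nonzero [simp]: "ppar \<noteq> 0"
  using ppar_square by auto

lemma inverse_ppar: "inverse ppar = - qpar * ppar"
  using ppar_square by (simp add: field_simps)

lemma qpar_powi_neq_1: "m \<noteq> 0 \<Longrightarrow> qpar powi m \<noteq> 1"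
proof (cases "m \<ge> 0")
  case True
  thus "m \<noteq> 0 \<Longrightarrow> ?thesis" using qpar_power_neq_1[of "nat m"] by (simp add: power_int_def)
next
  case False
  thus "m \<noteq> 0 \<Longrightarrow> ?thesis" using qpar_power_neq_1[of "nat (- m)"]
    by (auto simp: power_int_def field_simps)
qed

lemma qpar_square_neq_1: "qpar * qpar \<noteq> 1"
  using qpar_power_neq_1[of 2] by (simp add: power2_eq_square)

lemma qpar_diff_nonzero: "qpar - inverse qpar \<noteq> 0"
  using qpar_square_neq_1 by (simp add: field_simps)

lemma qnum_0 [simp]: "qnum 0 = 0"
  by (simp add: qnum_def)

lemma qnum_1 [simp]: "qnum 1 = 1"
  using qpar_diff_nonzero by (simp add: qnum_def power_int_minus)

lemma qnum_nonzero: "m \<noteq> 0 \<Longrightarrow> qnum m \<noteq> 0"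
proof -
  assume "m \<noteq> 0"
  hence "qpar powi (2 * m) \<noteq> 1" by (intro qpar_powi_neq_1) auto
  hence "qpar powi m \<noteq> qpar powi (- m)"
    using power_int_add[of qpar m m] by (simp add: power_int_minus field_simps)
  thus ?thesis using qpar_diff_nonzero by (simp add: qnum_def)
qed

lemma qi_nonzero [simp]: "qi \<epsilon> i \<noteq> 0"
  by (simp add: qi_def)

lemma ri_diff_nonzero: "ri n i - inverse (ri n i) \<noteq> 0"
proof -
  have "ppar \<noteq> inverse ppar"
  proof
    assume "ppar = inverse ppar"
    hence "ppar * ppar = 1" by (simp add: field_simps)
    hence "- inverse qpar = 1" by (simp add: ppar_square)
    hence "qpar = - 1" by (simp add: field_simps)
    hence "qpar * qpar = 1" by (metis minus_mult_minus mult_1)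
    thus False using qpar_square_neq_1 by simp
  qed
  thus ?thesis using qpar_diff_nonzero by (simp add: ri_def)
qed

text \<open>
  The relation for \<open>e_i\<close> and \<open>f_i\<close> between two sites that hold arbitrarily many particles.
\<close>
lemma qnum_commutator:
  "qnum a * qnum (b + 1) - qnum b * qnum (a + 1) = qnum (a - b)"
proof -
  define A B where "A = qpar powi a" and "B = qpar powi b"
  define d where "d = qpar - inverse qpar"
  have "A \<noteq> 0" "B \<noteq> 0" by (simp_all add: A_def B_def)
  have d: "d \<noteq> 0" using qpar_diff_nonzero by (simp add: d_def)
  have num: "(A - inverse A) * (B * qpar - inverse (B * qpar)) - (B - inverse B) * (A * qpar - inverse (A * qpar))
     = (A / B - B / A) * d"
    using \<open>A \<noteq> 0\<close> \<open>B \<noteq> 0\<close> by (simp add: d_def field_simps)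
  have "qnum a = (A - inverse A) / d" "qnum b = (B - inverse B) / d"
    by (simp_all add: qnum_def A_def B_def d_def power_int_minus)
  moreover have "qnum (a + 1) = (A * qpar - inverse (A * qpar)) / d"
      "qnum (b + 1) = (B * qpar - inverse (B * qpar)) / d"
    unfolding qnum_def d_def[symmetric] power_int_minus
    by (simp_all add: A_def B_def power_int_add)
  moreover have "qnum (a - b) = (A / B - B / A) / d"
    unfolding qnum_def d_def[symmetric] power_int_minus
    by (simp add: A_def B_def power_int_diff)
  ultimately have "qnum a * qnum (b + 1) - qnum b * qnum (a + 1) =
      ((A - inverse A) * (B * qpar - inverse (B * qpar)) - (B - inverse B) * (A * qpar - inverse (A * qpar))) / (d * d)"
    by (simp only: times_divide_times_eq flip: diff_divide_distrib)
  also have "\<dots> = qnum (a - b)"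
    unfolding num \<open>qnum (a - b) = _\<close> using d by simp
  finally show ?thesis .
qed

text \<open>
  The relation for \<open>e_n\<close> and \<open>f_n\<close>. That a difference of neighbouring q-numbers has this form is
  special to the parameter \<open>p\<close>, whose square is \<open>- 1/q\<close>.
\<close>
lemma qnum_step:
  "(ppar - inverse ppar) * (qnum (m + 1) - qnum m) = ppar * qpar powi (- m) - inverse (ppar * qpar powi (- m))"
proof -
  define A where "A = qpar powi m"
  have [simp]: "A \<noteq> 0" by (simp add: A_def)
  have 1: "qpar + 1 \<noteq> 0"
    using qpar_square_neq_1 by (metis add_eq_0_iff2 minus_mult_minus mult_1)
  have 2: "qpar - 1 \<noteq> 0"
    using qpar_power_neq_1[of 1] by simp
  have 3: "qpar - inverse qpar = (qpar - 1) * (qpar + 1) / qpar"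
    by (simp add: field_simps)
  have 4: "qpar powi (m + 1) = A * qpar" "qpar powi m = A"
    by (simp_all add: A_def power_int_add)
  have "qnum (m + 1) - qnum m =
      ((A * qpar - inverse (A * qpar)) - (A - inverse A)) / (qpar - inverse qpar)"
    unfolding qnum_def power_int_minus 4 by (simp add: diff_divide_distrib)
  also have "(A * qpar - inverse (A * qpar)) - (A - inverse A) = (A + inverse (A * qpar)) * (qpar - 1)"
    by (simp add: field_simps)
  also have "\<dots> / (qpar - inverse qpar) = (A + inverse (A * qpar)) * qpar / (qpar + 1)"
    unfolding 3 using 1 2 by (simp add: divide_simps)
  finally have "qnum (m + 1) - qnum m = (A + inverse (A * qpar)) * qpar / (qpar + 1)" .
  moreover have "ppar - inverse ppar = ppar * (qpar + 1)"
    by (simp add: inverse_ppar algebra_simps)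
  ultimately have "(ppar - inverse ppar) * (qnum (m + 1) - qnum m)
      = ppar * ((A + inverse (A * qpar)) * qpar)"
    using 1 by simp
  also have "(A + inverse (A * qpar)) * qpar = A * qpar + inverse A"
    by (simp add: field_simps)
  also have "ppar * (A * qpar + inverse A) = ppar * inverse A - inverse (ppar * inverse A)"
    by (simp add: inverse_ppar algebra_simps)
  finally show ?thesis
    by (simp add: power_int_minus A_def)
qed

section \<open>The relations on one tensor factor\<close>

text \<open>
  Bounds that hold at every site, without a case distinction, show that labels form a convex set.
\<close>
lemma labels_iff:
  "m \<in> labels \<kappa> \<kappa>' \<longleftrightarrow>
     (\<forall>l. 0 \<le> m l \<and> (l \<le> \<kappa> \<longrightarrow> m l \<le> 1) \<and> (l \<notin> {1..\<kappa> + \<kappa>'} \<longrightarrow> m l = 0))"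
  (is "?L \<longleftrightarrow> ?R")
proof
  assume m: ?L
  show ?R
  proof (intro allI conjI impI)
    fix l
    have 1: "m l \<in> {0, 1}" if "1 \<le> l" "l \<le> \<kappa>"
      using m that by (simp add: labels_def)
    have 2: "m l \<ge> 0" if "\<kappa> < l" "l \<le> \<kappa> + \<kappa>'"
      using m that by (simp add: labels_def)
    have 3: "m l = 0" if "l = 0 \<or> \<kappa> + \<kappa>' < l"
      using m that by (auto simp: labels_def)
    show "0 \<le> m l"
      using 1 2 3 by (cases "l = 0"; cases "l \<le> \<kappa>"; cases "l \<le> \<kappa> + \<kappa>'") auto
    show "m l \<le> 1" if "l \<le> \<kappa>"
      using 1 3 that by (cases "l = 0") auto
    show "m l = 0" if "l \<notin> {1..\<kappa> + \<kappa>'}" using 3 that by auto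
  qed
next
  assume m: ?R
  have "m i \<in> {0, 1}" if "i \<in> {1..\<kappa>}" for i
    using m[rule_format, of i] that by auto
  thus ?L using m by (simp add: labels_def)
qed

abbreviation act :: "nat \<Rightarrow> nat \<Rightarrow> scalar \<Rightarrow> gen \<Rightarrow> (label \<Rightarrow>\<^sub>0 scalar) \<Rightarrow> (label \<Rightarrow>\<^sub>0 scalar)" where
  "act \<kappa> \<kappa>' z g \<equiv> lin_ext (rep_ket \<kappa> \<kappa>' z g)"

lemma rep_word_gen [simp]: "rep_word \<kappa> \<kappa>' z (Word [g]) = act \<kappa> \<kappa>' z g"
  by (simp add: rep_word_def fun_eq_iff)

text \<open>
  The weight of \<open>e_j\<close>: it is added to a label by \<open>e_j\<close> and subtracted by \<open>f_j\<close>. Cutting it off outside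
  of \<open>{1..n}\<close> makes the two ends of the chain, where particles enter and leave, no exceptions.
\<close>
definition shift :: "nat \<Rightarrow> nat \<Rightarrow> label" where
  "shift n j = (\<lambda>l. if l \<in> {1..n} then of_bool (l = j + 1) - of_bool (l = j) else 0)"

definition ecoef :: "scalar \<Rightarrow> nat \<Rightarrow> label \<Rightarrow> scalar" where
  "ecoef z i m = (if i = 0 then z else qnum (m i))"

definition fcoef :: "nat \<Rightarrow> scalar \<Rightarrow> nat \<Rightarrow> label \<Rightarrow> scalar" where
  "fcoef n z i m =
     (if i = 0 then inverse z * qnum (m 1) else if i < n then qnum (m (i + 1)) else 1)"

lemma ket_label [simp]: "m \<in> labels \<kappa> \<kappa>' \<Longrightarrow> ket \<kappa> \<kappa>' m = bas m"
  and ket_nonlabel [simp]: "m \<notin> labels \<kappa> \<kappa>' \<Longrightarrow> ket \<kappa> \<kappa>' m = 0"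
  by (simp_all add: ket_def)

locale chain =
  fixes \<kappa> \<kappa>' n :: nat
  assumes kappa_pos: "\<kappa> \<ge> 1" and kappa'_pos: "\<kappa>' \<ge> 1" and n_def: "n = \<kappa> + \<kappa>'"
begin

abbreviation "L \<equiv> labels \<kappa> \<kappa>'"
abbreviation "\<epsilon> \<equiv> eps \<kappa>"
abbreviation "sh \<equiv> shift n"
abbreviation "D \<equiv> Dcoef n \<epsilon>"
abbreviation "kv \<equiv> kval \<kappa> \<kappa>'"
abbreviation "act1 \<equiv> act \<kappa> \<kappa>'"
abbreviation "ket1 \<equiv> ket \<kappa> \<kappa>'"

lemma rep_ket_e: "i \<le> n \<Longrightarrow> rep_ket \<kappa> \<kappa>' z (gen_e i) m = smul (ecoef z i m) (ket1 (m + sh i))"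
proof -
  assume "i \<le> n"
  have "ee 1 = sh 0"
    "\<And>m :: label. i > 0 \<Longrightarrow> i < n \<Longrightarrow> m - ee i + ee (i + 1) = m + sh i"
    "\<And>m :: label. m - ee n = m + sh n"
    using kappa_pos n_def by (auto simp: fun_eq_iff ee_def shift_def)
  note eqs = this
  consider "i = 0" | "0 < i" "i < n" | "i = n" "0 < n" using \<open>i \<le> n\<close> kappa_pos n_def by linarith
  thus ?thesis
    by cases (simp_all add: ecoef_def eqs(1)[unfolded One_nat_def] eqs(2)[unfolded Suc_eq_plus1[symmetric]] eqs(3) flip: n_def del: diff_add_eq)
qed

lemma rep_ket_f: "i \<le> n \<Longrightarrow> rep_ket \<kappa> \<kappa>' z (gen_f i) m = smul (fcoef n z i m) (ket1 (m - sh i))"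
proof -
  assume "i \<le> n"
  have "ee 1 = sh 0"
    "\<And>m :: label. i > 0 \<Longrightarrow> i < n \<Longrightarrow> m + ee i - ee (i + 1) = m - sh i"
    "ee n = - sh n"
    using kappa_pos n_def by (auto simp: fun_eq_iff ee_def shift_def)
  note eqs = this
  consider "i = 0" | "0 < i" "i < n" | "i = n" "0 < n" using \<open>i \<le> n\<close> kappa_pos n_def by linarith
  thus ?thesis
    by cases (simp_all add: fcoef_def eqs(1)[unfolded One_nat_def] eqs(2)[unfolded Suc_eq_plus1[symmetric]] eqs(3) flip: n_def)
qed

lemma plus_sh_label_iff:
  assumes "m \<in> L" "i \<le> n"
  shows "m + sh i \<in> L \<longleftrightarrow> (i \<ge> 1 \<longrightarrow> m i \<ge> 1) \<and> (i < \<kappa> \<longrightarrow> m (i + 1) = 0)"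
proof
  assume R: "(i \<ge> 1 \<longrightarrow> m i \<ge> 1) \<and> (i < \<kappa> \<longrightarrow> m (i + 1) = 0)"
  show "m + sh i \<in> L"
    unfolding labels_iff
  proof
    fix l
    show "0 \<le> (m + sh i) l \<and> (l \<le> \<kappa> \<longrightarrow> (m + sh i) l \<le> 1) \<and> (l \<notin> {1..\<kappa> + \<kappa>'} \<longrightarrow> (m + sh i) l = 0)"
      using assms(1)[unfolded labels_iff, rule_format, of l] R assms(2)
      by (auto simp: shift_def n_def)
  qed
next
  assume "m + sh i \<in> L"
  from this[unfolded labels_iff, rule_format, of i] this[unfolded labels_iff, rule_format, of "i + 1"]
    assms(1)[unfolded labels_iff, rule_format, of "i + 1"]
  show "(i \<ge> 1 \<longrightarrow> m i \<ge> 1) \<and> (i < \<kappa> \<longrightarrow> m (i + 1) = 0)"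
    using assms(2) by (auto simp: shift_def n_def split: if_splits)
qed

lemma minus_sh_label_iff:
  assumes "m \<in> L" "i \<le> n"
  shows "m - sh i \<in> L \<longleftrightarrow> (i < n \<longrightarrow> m (i + 1) \<ge> 1) \<and> (1 \<le> i \<and> i \<le> \<kappa> \<longrightarrow> m i = 0)"
proof
  assume R: "(i < n \<longrightarrow> m (i + 1) \<ge> 1) \<and> (1 \<le> i \<and> i \<le> \<kappa> \<longrightarrow> m i = 0)"
  show "m - sh i \<in> L"
    unfolding labels_iff
  proof
    fix l
    show "0 \<le> (m - sh i) l \<and> (l \<le> \<kappa> \<longrightarrow> (m - sh i) l \<le> 1) \<and> (l \<notin> {1..\<kappa> + \<kappa>'} \<longrightarrow> (m - sh i) l = 0)"
      using assms(1)[unfolded labels_iff, rule_format, of l] R assms(2)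
      by (auto simp: shift_def n_def)
  qed
next
  assume "m - sh i \<in> L"
  from this[unfolded labels_iff, rule_format, of i] this[unfolded labels_iff, rule_format, of "i + 1"]
    assms(1)[unfolded labels_iff, rule_format, of i]
  show "(i < n \<longrightarrow> m (i + 1) \<ge> 1) \<and> (1 \<le> i \<and> i \<le> \<kappa> \<longrightarrow> m i = 0)"
    using assms(2) by (auto simp: shift_def n_def split: if_splits)
qed

text \<open>
  If the result of \<open>e_i f_j\<close> is a label, then no intermediate configuration is forbidden: at every site
  its occupation lies between the initial and the final one, since for \<open>i \<noteq> j\<close> the moves never
  cancel each other.
\<close>
lemma intermediate_labels:
  assumes "m \<in> L" "m - sh j + sh i \<in> L" "i \<noteq> j"
  shows "m - sh j \<in> L" "m + sh i \<in> L"
proof -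
  \<comment> \<open>Convexity of the set of labels.\<close>
  have between: "m' \<in> L" if "\<And>l. (m l \<le> m' l \<and> m' l \<le> (m - sh j + sh i) l)
      \<or> (m' l \<le> m l \<and> (m - sh j + sh i) l \<le> m' l)" for m'
    unfolding labels_iff
  proof
    fix l
    show "0 \<le> m' l \<and> (l \<le> \<kappa> \<longrightarrow> m' l \<le> 1) \<and> (l \<notin> {1..\<kappa> + \<kappa>'} \<longrightarrow> m' l = 0)"
      using assms(1)[unfolded labels_iff, rule_format, of l] that[of l]
        assms(2)[unfolded labels_iff, rule_format, of l] by linarith
  qed
  show "m - sh j \<in> L" using assms(3) by (intro between) (auto simp: shift_def)
  show "m + sh i \<in> L" using assms(3) by (intro between) (auto simp: shift_def)
qed

lemma nbr_cases: "i \<le> n \<Longrightarrow> nbr n i = (if i = 0 then {1} else if i < n then {i, i + 1} else {n})"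
  using kappa_pos n_def by (auto simp: nbr_def)

lemma kval_plus:
  assumes "i \<le> n"
  shows "kv i (m + s) = kv i m * (\<Prod>l\<in>nbr n i. qi \<epsilon> l powi (if l = i then - s l else s l))"
proof -
  have split: "qi \<epsilon> l powi (- a - b) = qi \<epsilon> l powi (- a) * qi \<epsilon> l powi (- b)" for l a b
    using power_int_add[of "qi \<epsilon> l" "- a" "- b"] by simp
  consider "i = 0" | "0 < i" "i < n" | "i = n" "0 < n" using assms kappa_pos n_def by linarith
  thus ?thesis
    by cases (simp_all add: split kval_def nbr_cases power_int_add mult_ac flip: n_def)
qed

lemma Dcoef_commute: "D i j = D j i"
  by (simp add: Dcoef_def Int_commute eq_commute)

lemma Dcoef_nonzero [simp]: "D i j \<noteq> 0"
  by (simp add: Dcoef_def nbr_def)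

lemma kval_nonzero [simp]: "kv i m \<noteq> 0"
  by (simp add: kval_def)

text \<open>
  The weight of \<open>e_j\<close> is concentrated on the sites next to \<open>j\<close>, so that of the sites which \<open>k_i\<close> looks at
  only the common ones contribute. This is the product that defines \<open>D\<close>.
\<close>
lemma kval_plus_sh:
  assumes "i \<le> n" "j \<le> n"
  shows "kv i (m + sh j) = D i j * kv i m"
proof -
  have "D i j = (\<Prod>l\<in>nbr n i. qi \<epsilon> l powi (if l = i then - sh j l else sh j l))"
    unfolding Dcoef_def
    by (rule prod.mono_neutral_cong_left) (auto simp: nbr_def shift_def)
  thus ?thesis using kval_plus[OF assms(1)] by simp
qed

lemma kval_minus_sh:
  assumes "i \<le> n" "j \<le> n"
  shows "kv i (m - sh j) = inverse (D i j) * kv i m"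
  using kval_plus_sh[OF assms, of "m - sh j"] by simp

lemma act_e_ket: "i \<le> n \<Longrightarrow> act1 z (gen_e i) (ket1 m) =
    (if m \<in> L then smul (ecoef z i m) (ket1 (m + sh i)) else 0)"
  and act_f_ket: "i \<le> n \<Longrightarrow> act1 z (gen_f i) (ket1 m) =
    (if m \<in> L then smul (fcoef n z i m) (ket1 (m - sh i)) else 0)"
  by (simp_all add: rep_ket_e rep_ket_f lin_ext_simps del: rep_ket.simps)

lemma act_k_ket: "act1 z (gen_k i) (ket1 m) = smul (kv i m) (ket1 m)"
  and act_kinv_ket: "act1 z (gen_kinv i) (ket1 m) = smul (inverse (kv i m)) (ket1 m)"
  by (cases "m \<in> L"; simp add: lin_ext_simps)+

lemma act_k:
  assumes "m \<in> L"
  shows "act1 z (gen_k i) (bas m) = smul (kv i m) (bas m)"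
    "act1 z (gen_kinv i) (bas m) = smul (inverse (kv i m)) (bas m)"
  using act_k_ket[of z i m] act_kinv_ket[of z i m] assms by simp_all

lemma act_k_ef:
  assumes "m \<in> L" "i \<le> n" "j \<le> n"
  shows "act1 z (gen_k i) (act1 z (gen_e j) (bas m)) = smul (D i j * kv i m) (act1 z (gen_e j) (bas m))"
    "act1 z (gen_kinv i) (act1 z (gen_e j) (bas m)) = smul (inverse (D i j * kv i m)) (act1 z (gen_e j) (bas m))"
    "act1 z (gen_k i) (act1 z (gen_f j) (bas m)) = smul (inverse (D i j) * kv i m) (act1 z (gen_f j) (bas m))"
    "act1 z (gen_kinv i) (act1 z (gen_f j) (bas m)) = smul (D i j * inverse (kv i m)) (act1 z (gen_f j) (bas m))"
proof -
  have e: "act1 z (gen_e j) (bas m) = smul (ecoef z j m) (ket1 (m + sh j))"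
    and f: "act1 z (gen_f j) (bas m) = smul (fcoef n z j m) (ket1 (m - sh j))"
    using act_e_ket[of j z m] act_f_ket[of j z m] assms by simp_all
  show "act1 z (gen_k i) (act1 z (gen_e j) (bas m)) = smul (D i j * kv i m) (act1 z (gen_e j) (bas m))"
    "act1 z (gen_kinv i) (act1 z (gen_e j) (bas m)) = smul (inverse (D i j * kv i m)) (act1 z (gen_e j) (bas m))"
    "act1 z (gen_k i) (act1 z (gen_f j) (bas m)) = smul (inverse (D i j) * kv i m) (act1 z (gen_f j) (bas m))"
    "act1 z (gen_kinv i) (act1 z (gen_f j) (bas m)) = smul (D i j * inverse (kv i m)) (act1 z (gen_f j) (bas m))"
    using assms(2,3) unfolding e f
    by (simp_all add: lin_ext_simps act_k_ket act_kinv_ket kval_plus_sh kval_minus_sh mult_ac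
        del: ket_label ket_nonlabel)
qed

text \<open>
  The scalar form of the relation for \<open>e_i\<close> and \<open>f_i\<close>. An illegal intermediate label is recorded as a
  vanishing term. If one of the sites involved holds at most one particle, at most one of the two terms survives;
  otherwise the relation is one of the two identities for q-numbers above.
\<close>
lemma ef_diagonal:
  assumes "m \<in> L" "i \<le> n" "z \<noteq> 0"
  shows "fcoef n z i m * (if m - sh i \<in> L then ecoef z i (m - sh i) else 0)
       - ecoef z i m * (if m + sh i \<in> L then fcoef n z i (m + sh i) else 0)
       = (kv i m - inverse (kv i m)) / (ri n i - inverse (ri n i))"
proof -
  have range: "0 \<le> m l" "l \<le> \<kappa> \<Longrightarrow> m l \<le> 1" for l
    using assms(1) by (simp_all add: labels_iff)
  have bin: "m l = 0 \<or> m l = 1" if "l \<le> \<kappa>" for l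
    using range[of l] that by linarith
  have P: "ppar - inverse ppar \<noteq> 0" using ri_diff_nonzero[of n 0] by (simp add: ri_def)
  have up: "m + sh i \<in> L \<longleftrightarrow> (i \<ge> 1 \<longrightarrow> m i \<ge> 1) \<and> (i < \<kappa> \<longrightarrow> m (i + 1) = 0)"
    using assms by (intro plus_sh_label_iff)
  have down: "m - sh i \<in> L \<longleftrightarrow> (i < n \<longrightarrow> m (i + 1) \<ge> 1) \<and> (1 \<le> i \<and> i \<le> \<kappa> \<longrightarrow> m i = 0)"
    using assms by (intro minus_sh_label_iff)
  consider "i = 0" | "0 < i" "i < n" | "i = n"
    using assms(2) by linarith
  thus ?thesis
  proof cases
    case 1
    have kv: "kv 0 m = inverse ppar * (- inverse qpar) powi m 1"
      using kappa_pos by (simp add: kval_def qi_def eps_def)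
    have pq: "inverse ppar * (- inverse qpar) = ppar"
      using ppar_square by (metis mult.assoc mult.left_commute mult.right_neutral ppar_nonzero right_inverse)
    have sh: "(m - sh 0) 1 = m 1 - 1" "(m + sh 0) 1 = m 1 + 1"
      using kappa_pos n_def by (simp_all add: shift_def)
    have "kv 0 m = inverse ppar \<and> m 1 = 0 \<or> kv 0 m = ppar \<and> m 1 = 1"
      using bin[of 1] kappa_pos pq by (auto simp: kv)
    moreover have "(inverse ppar - ppar) / (ppar - inverse ppar) = - 1"
      "(ppar - inverse ppar) / (ppar - inverse ppar) = 1"
      using P by (simp_all add: divide_eq_eq)
    moreover have "0 < n" "\<kappa> > 0" using kappa_pos n_def by simp_all
    ultimately show ?thesis
      using assms(3) P sh unfolding 1 up[unfolded 1] down[unfolded 1]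
      by (auto simp: ecoef_def fcoef_def ri_def)
  next
    case 2
    have coefs: "ecoef z i (m - sh i) = qnum (m i + 1)" "ecoef z i m = qnum (m i)"
      "fcoef n z i m = qnum (m (i + 1))" "fcoef n z i (m + sh i) = qnum (m (i + 1) + 1)"
      using 2 by (simp_all add: ecoef_def fcoef_def shift_def)
    have kv: "kv i m = qi \<epsilon> i powi (- m i) * qi \<epsilon> (i + 1) powi m (i + 1)"
      using 2 by (simp add: kval_def flip: n_def)
    have ri: "ri n i = qpar" using 2 by (simp add: ri_def)
    have qn: "qnum k = (qpar powi k - inverse (qpar powi k)) / (qpar - inverse qpar)" for k
      by (simp add: qnum_def power_int_minus)
    consider "i < \<kappa>" | "i = \<kappa>" | "\<kappa> < i" by linarith
    thus ?thesis
    proof cases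
      case 1
      have k: "kv i m = (- inverse qpar) powi (- m i) * (- inverse qpar) powi m (i + 1)"
        unfolding kv using 1 by (simp add: qi_def eps_def)
      have "(inverse qpar - qpar) / (qpar - inverse qpar) = - 1"
        "(qpar - inverse qpar) / (qpar - inverse qpar) = 1"
        using qpar_diff_nonzero by (simp_all add: divide_eq_eq)
      thus ?thesis
        using bin[of i] bin[of "i + 1"] 1 2 unfolding coefs ri k up down
        by (auto simp: power_int_minus)
    next
      case 2
      have k: "kv i m = (- inverse qpar) powi (- m i) * qpar powi m (i + 1)"
        unfolding kv using 2 by (simp add: qi_def eps_def)
      have nonneg: "m (i + 1) = 0 \<or> m (i + 1) \<ge> 1" using range[of "i + 1"] by linarith
      from bin[of i] 2 have "m i = 0 \<or> m i = 1" by simp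
      thus ?thesis
      proof
        assume 0: "m i = 0"
        have "kv i m = qpar powi m (i + 1)" using 0 by (simp add: k)
        thus ?thesis using nonneg 0 2 \<open>0 < i\<close> \<open>i < n\<close> unfolding coefs ri up down
          by (auto simp: qn)
      next
        assume 1: "m i = 1"
        have k1: "kv i m = - (qpar powi (m (i + 1) + 1))"
          using 1 by (simp add: k power_int_minus power_int_add)
        have "(kv i m - inverse (kv i m)) / (qpar - inverse qpar) = - qnum (m (i + 1) + 1)"
          unfolding k1 qn by (simp add: divide_simps) (simp add: algebra_simps)
        thus ?thesis using nonneg 1 2 \<open>0 < i\<close> \<open>i < n\<close> unfolding coefs ri up down
          by simp
      qed
    next
      case 3
      have k: "kv i m = qpar powi (m (i + 1) - m i)"
        unfolding kv using 3 by (simp add: qi_def eps_def power_int_diff power_int_minus field_simps)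
      have "m i = 0 \<or> m i \<ge> 1" "m (i + 1) = 0 \<or> m (i + 1) \<ge> 1"
        using range[of i] range[of "i + 1"] by linarith+
      thus ?thesis
        unfolding coefs ri k up down qn[symmetric] qnum_commutator[symmetric]
        using 3 \<open>0 < i\<close> \<open>i < n\<close> by auto
    qed
  next
    case 3
    have n: "0 < n" "\<kappa> < n" using kappa_pos kappa'_pos n_def by simp_all
    have coefs: "ecoef z n (m - sh n) = qnum (m n + 1)" "ecoef z n m = qnum (m n)"
      "fcoef n z n m = 1" "fcoef n z n (m + sh n) = 1" "ri n n = ppar"
      using n by (simp_all add: ecoef_def fcoef_def shift_def ri_def)
    have "m n = 0 \<or> m n \<ge> 1" using range[of n] by linarith
    moreover have k: "kv n m = ppar * qpar powi (- m n)"
      using n by (simp add: kval_def qi_def eps_def flip: n_def)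
    moreover have "(kv n m - inverse (kv n m)) / (ppar - inverse ppar) = qnum (m n + 1) - qnum (m n)"
      unfolding k qnum_step[symmetric] using P by simp
    ultimately show ?thesis unfolding 3 coefs up[unfolded 3] down[unfolded 3]
      using n by auto
  qed
qed

text \<open>
  For \<open>i \<noteq> j\<close> the coefficients influence each other only if \<open>i = j + 1\<close>, when both generators take
  a particle from site \<open>i\<close>; in either order they contribute \<open>[m_i] [m_i - 1]\<close>.
\<close>
lemma act_ef:
  assumes "m \<in> L" "i \<le> n" "j \<le> n" "z \<noteq> 0"
  shows "act1 z (gen_e i) (act1 z (gen_f j) (bas m)) =
     act1 z (gen_f j) (act1 z (gen_e i) (bas m))
     + smul (of_bool (i = j) / (ri n i - inverse (ri n i)) * (kv i m - inverse (kv i m))) (bas m)"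
proof -
  have e: "act1 z (gen_e i) (bas m) = smul (ecoef z i m) (ket1 (m + sh i))"
    and f: "act1 z (gen_f j) (bas m) = smul (fcoef n z j m) (ket1 (m - sh j))"
    using act_e_ket[of i z m] act_f_ket[of j z m] assms by simp_all
  have ef: "act1 z (gen_e i) (act1 z (gen_f j) (bas m)) =
     smul (fcoef n z j m * (if m - sh j \<in> L then ecoef z i (m - sh j) else 0)) (ket1 (m - sh j + sh i))"
    unfolding f using assms by (simp add: lin_ext_simps act_e_ket del: ket_label ket_nonlabel)
  have fe: "act1 z (gen_f j) (act1 z (gen_e i) (bas m)) =
     smul (ecoef z i m * (if m + sh i \<in> L then fcoef n z j (m + sh i) else 0)) (ket1 (m - sh j + sh i))"
    unfolding e using assms by (simp add: lin_ext_simps act_f_ket algebra_simps del: ket_label ket_nonlabel)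
  show ?thesis
  proof (cases "i = j")
    case True
    have sum_eq: "A = B + C" if "A - B = C" for A B C :: scalar
      using that by (simp add: algebra_simps)
    have *: "fcoef n z j m * (if m - sh j \<in> L then ecoef z i (m - sh j) else 0)
      = ecoef z i m * (if m + sh i \<in> L then fcoef n z j (m + sh i) else 0)
        + of_bool (i = j) / (ri n i - inverse (ri n i)) * (kv i m - inverse (kv i m))"
      using sum_eq[OF ef_diagonal[OF assms(1,2,4)]] unfolding True by simp
    have "ket1 (m - sh j + sh i) = bas m" using True assms(1) by simp
    thus ?thesis unfolding ef fe * by (simp only: pm.scale_left_distrib)
  next
    case False
    have "fcoef n z j m * ecoef z i (m - sh j) = ecoef z i m * fcoef n z j (m + sh i)"
      using False assms(2,3) kappa_pos n_def
      by (cases "i = j + 1") (auto simp: fcoef_def ecoef_def shift_def)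
    thus ?thesis using False intermediate_labels[OF assms(1) _ False] unfolding ef fe
      by (cases "m - sh j + sh i \<in> L") auto
  qed
qed

end

section \<open>The algebra acts on the tensor product\<close>

lemma gvar_carrier:
  "gen_index g \<le> n \<Longrightarrow> gvar g \<in> carrier (free_ring n)"
  by (simp add: free_ring_def gvar_def)

lemma one_carrier: "1 \<in> carrier (free_ring n)"
  by (simp add: free_ring_def zero_gword_def)

lemma free_ring_closed:
  assumes "a \<in> carrier (free_ring n)" "b \<in> carrier (free_ring n)"
  shows "a * b \<in> carrier (free_ring n)" "a + b \<in> carrier (free_ring n)"
    "a - b \<in> carrier (free_ring n)"
proof -
  show "a * b \<in> carrier (free_ring n)"
    using assms keys_mult[of a b] by (fastforce simp: free_ring_def plus_gword_def)
  show "a + b \<in> carrier (free_ring n)"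
    using assms keys_add[of a b] by (fastforce simp: free_ring_def)
  show "a - b \<in> carrier (free_ring n)"
    using assms by (auto simp: free_ring_def in_keys_iff lookup_minus)
qed

lemma free_ring_closed':
  assumes "a \<in> carrier (free_ring n)"
  shows "- a \<in> carrier (free_ring n)" "smul c a \<in> carrier (free_ring n)"
  using assms keys_smul_subset[of c a] by (auto simp: free_ring_def in_keys_iff)

lemma free_ring_ops [simp]:
  "mult (free_ring n) = (*)" "one (free_ring n) = 1"
  "zero (free_ring n) = 0" "add (free_ring n) = (+)"
  by (simp_all add: free_ring_def)

lemma ring_free_ring: "ring (free_ring n)"
proof (rule ringI)
  show "abelian_group (free_ring n)"
  proof (rule abelian_groupI)
    fix a assume "a \<in> carrier (free_ring n)"
    thus "\<exists>b\<in>carrier (free_ring n). b \<oplus>\<^bsub>free_ring n\<^esub> a = \<zero>\<^bsub>free_ring n\<^esub>"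
      by (intro bexI[of _ "- a"]) (auto intro: free_ring_closed free_ring_closed')
  qed (auto simp: algebra_simps intro: free_ring_closed, simp add: free_ring_def)
  show "Group.monoid (free_ring n)"
    by (rule monoidI) (auto simp: mult.assoc intro: free_ring_closed one_carrier)
qed (auto simp: algebra_simps)

lemma WW_closed:
  assumes "v \<in> WW \<kappa> \<kappa>'" "w \<in> WW \<kappa> \<kappa>'"
  shows "v + w \<in> WW \<kappa> \<kappa>'" "- v \<in> WW \<kappa> \<kappa>'"
  using assms keys_add[of v w] by (auto simp: WW_def in_keys_iff)

lemma smul_WW: "v \<in> WW \<kappa> \<kappa>' \<Longrightarrow> smul c v \<in> WW \<kappa> \<kappa>'"
  using keys_smul_subset[of c v] by (auto simp: WW_def)

lemma zero_WW [simp]: "0 \<in> WW \<kappa> \<kappa>'"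
  by (simp add: WW_def)

lemma sum_WW: "(\<And>a. a \<in> A \<Longrightarrow> f a \<in> WW \<kappa> \<kappa>') \<Longrightarrow> sum f A \<in> WW \<kappa> \<kappa>'"
  by (induction A rule: infinite_finite_induct) (simp_all add: WW_closed)

lemma lin_ext_WW:
  assumes "\<And>a. a \<in> Poly_Mapping.keys t \<Longrightarrow> f a \<in> WW \<kappa> \<kappa>'"
  shows "lin_ext f t \<in> WW \<kappa> \<kappa>'"
  unfolding lin_ext_def by (intro sum_WW smul_WW assms)

abbreviation rho :: "nat \<Rightarrow> nat \<Rightarrow> free_alg \<Rightarrow> (label \<times> label \<Rightarrow>\<^sub>0 scalar) \<Rightarrow> (label \<times> label \<Rightarrow>\<^sub>0 scalar)"
  where "rho \<kappa> \<kappa>' a \<equiv> rep2 \<kappa> \<kappa>' (coprod a)"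

lemmas rho_left = linmap_simps[OF linmap_compose[OF linmap_coprod linmap_rep2_left]]
lemmas rho_right = linmap_simps[OF linmap_rep2_right]

lemma rho_mult: "rho \<kappa> \<kappa>' (a * b) v = rho \<kappa> \<kappa>' a (rho \<kappa> \<kappa>' b v)"
  by (simp add: coprod_mult rep2_mult)

lemma keys_rep_ket: "Poly_Mapping.keys (rep_ket \<kappa> \<kappa>' z g m) \<subseteq> labels \<kappa> \<kappa>'"
proof -
  have *: "Poly_Mapping.keys (smul c (ket \<kappa> \<kappa>' m)) \<subseteq> labels \<kappa> \<kappa>'"
    "Poly_Mapping.keys (ket \<kappa> \<kappa>' m) \<subseteq> labels \<kappa> \<kappa>'" for c m
    using keys_smul_subset[of c "ket \<kappa> \<kappa>' m"] by (auto simp: ket_def split: if_splits)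
  show ?thesis by (cases g) (simp_all add: *)
qed

lemma keys_rep_word:
  assumes "m \<in> labels \<kappa> \<kappa>'"
  shows "Poly_Mapping.keys (rep_word \<kappa> \<kappa>' z w (bas m)) \<subseteq> labels \<kappa> \<kappa>'"
proof (cases "letters w")
  case (Cons g gs)
  have "Poly_Mapping.keys (act \<kappa> \<kappa>' z g u) \<subseteq> labels \<kappa> \<kappa>'" for u
  proof
    fix k assume k: "k \<in> Poly_Mapping.keys (act \<kappa> \<kappa>' z g u)"
    show "k \<in> labels \<kappa> \<kappa>'"
    proof (rule ccontr)
      assume "k \<notin> labels \<kappa> \<kappa>'"
      hence "Poly_Mapping.lookup (rep_ket \<kappa> \<kappa>' z g m) k = 0" for m
        using keys_rep_ket[of \<kappa> \<kappa>' z g m] by (metis in_keys_iff subsetD)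
      hence "Poly_Mapping.lookup (act \<kappa> \<kappa>' z g u) k = 0"
        unfolding lookup_lin_ext by (intro sum.neutral) simp
      thus False using k by (simp add: in_keys_iff)
    qed
  qed
  thus ?thesis unfolding rep_word_def Cons by simp
qed (use assms in \<open>simp add: rep_word_def\<close>)

lemma rep2_WW:
  assumes "v \<in> WW \<kappa> \<kappa>'"
  shows "rep2 \<kappa> \<kappa>' t v \<in> WW \<kappa> \<kappa>'"
proof -
  have basis: "tens_op (rep_word \<kappa> \<kappa>' xvar w) (rep_word \<kappa> \<kappa>' yvar w') (bas (m, m')) \<in> WW \<kappa> \<kappa>'"
    if "m \<in> labels \<kappa> \<kappa>'" "m' \<in> labels \<kappa> \<kappa>'" for w w' m m'
    using keys_rep_word[OF that(1), of xvar w] keys_rep_word[OF that(2), of yvar w']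
    by (auto simp: WW_def in_keys_iff)
  have "tens_op (rep_word \<kappa> \<kappa>' xvar w) (rep_word \<kappa> \<kappa>' yvar w') v \<in> WW \<kappa> \<kappa>'" for w w'
    unfolding tens_op_def
  proof (rule lin_ext_WW)
    fix k assume "k \<in> Poly_Mapping.keys v"
    with assms have "k \<in> labels \<kappa> \<kappa>' \<times> labels \<kappa> \<kappa>'" by (auto simp: WW_def)
    thus "(case k of (a, b) \<Rightarrow> tens (rep_word \<kappa> \<kappa>' xvar w (bas a)) (rep_word \<kappa> \<kappa>' yvar w' (bas b)))
        \<in> WW \<kappa> \<kappa>'"
      using basis by (cases k) simp
  qed
  thus ?thesis unfolding rep2_def by (intro lin_ext_WW) (simp split: prod.split)
qed

lemma rho_gen_tens:
  "rho \<kappa> \<kappa>' (ge i) (tens u v) = tens u (act \<kappa> \<kappa>' yvar (gen_e i) v)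
     + tens (act \<kappa> \<kappa>' xvar (gen_e i) u) (act \<kappa> \<kappa>' yvar (gen_k i) v)"
  "rho \<kappa> \<kappa>' (gf i) (tens u v) = tens (act \<kappa> \<kappa>' xvar (gen_f i) u) v
     + tens (act \<kappa> \<kappa>' xvar (gen_kinv i) u) (act \<kappa> \<kappa>' yvar (gen_f i) v)"
  "rho \<kappa> \<kappa>' (gk i) (tens u v) = tens (act \<kappa> \<kappa>' xvar (gen_k i) u) (act \<kappa> \<kappa>' yvar (gen_k i) v)"
  "rho \<kappa> \<kappa>' (gkinv i) (tens u v) = tens (act \<kappa> \<kappa>' xvar (gen_kinv i) u) (act \<kappa> \<kappa>' yvar (gen_kinv i) v)"
proof -
  have one: "(1 :: free_alg) = bas 0" by simp
  have [simp]: "tens (1 :: free_alg) (gvar g) = bas (0, Word [g])" "tens (gvar g) (1 :: free_alg) = bas (Word [g], 0)"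
    "tens (gvar g) (gvar h) = bas (Word [g], Word [h])" for g h
    unfolding one gvar_def by (simp_all only: tens_bas)
  have [simp]: "rep2 \<kappa> \<kappa>' (s + t) w = rep2 \<kappa> \<kappa>' s w + rep2 \<kappa> \<kappa>' t w" for s t w
    by (rule linmap_simps(1)[OF linmap_rep2_left])
  have [simp]: "rep_word \<kappa> \<kappa>' z (Word [g]) = act \<kappa> \<kappa>' z g" for z g
    by (rule ext) simp
  show
  "rho \<kappa> \<kappa>' (ge i) (tens u v) = tens u (act \<kappa> \<kappa>' yvar (gen_e i) v)
     + tens (act \<kappa> \<kappa>' xvar (gen_e i) u) (act \<kappa> \<kappa>' yvar (gen_k i) v)"
  "rho \<kappa> \<kappa>' (gf i) (tens u v) = tens (act \<kappa> \<kappa>' xvar (gen_f i) u) v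
     + tens (act \<kappa> \<kappa>' xvar (gen_kinv i) u) (act \<kappa> \<kappa>' yvar (gen_f i) v)"
  "rho \<kappa> \<kappa>' (gk i) (tens u v) = tens (act \<kappa> \<kappa>' xvar (gen_k i) u) (act \<kappa> \<kappa>' yvar (gen_k i) v)"
  "rho \<kappa> \<kappa>' (gkinv i) (tens u v) = tens (act \<kappa> \<kappa>' xvar (gen_kinv i) u) (act \<kappa> \<kappa>' yvar (gen_kinv i) v)"
    by (simp_all add: coprod_gvar tens_op_tens linmap_lin_ext linmap_id)
qed

context chain begin

abbreviation "WW2 \<equiv> WW \<kappa> \<kappa>'"
abbreviation "\<rho> \<equiv> rho \<kappa> \<kappa>'"
abbreviation "FR \<equiv> free_ring n"
abbreviation "RelI \<equiv> genideal FR (UB_rels n \<epsilon>)"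

text \<open>
  An ideal that contains the defining relations, hence the ideal of relations; its elements act by
  zero, so that the action descends to the quotient.
\<close>
definition annihilator :: "free_alg set" where
  "annihilator = {a \<in> carrier FR. \<forall>v\<in>WW2. \<rho> a v = 0}"

lemma annihilator_ideal: "ideal annihilator FR"
proof -
  interpret FR: ring FR by (rule ring_free_ring)
  have inv: "a_inv FR a = - a" if "a \<in> carrier FR" for a
    by (rule FR.minus_equality) (use that in \<open>auto intro: free_ring_closed'\<close>)
  have sub: "annihilator \<subseteq> carrier FR" by (auto simp: annihilator_def)
  have zero: "0 \<in> annihilator"
    using FR.zero_closed by (simp add: annihilator_def rho_left)
  have neg: "- a \<in> annihilator" if "a \<in> annihilator" for a
    using that by (simp add: annihilator_def rho_left free_ring_closed free_ring_closed')
  have add: "a + b \<in> annihilator" if "a \<in> annihilator" "b \<in> annihilator" for a b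
    using that by (simp add: annihilator_def rho_left free_ring_closed free_ring_closed')
  have mult: "a * b \<in> annihilator" "b * a \<in> annihilator"
    if "a \<in> annihilator" "b \<in> carrier FR" for a b
    using that by (simp_all add: annihilator_def rho_mult rho_right rep2_WW free_ring_closed free_ring_closed')
  show ?thesis
  proof (rule idealI[OF ring_free_ring])
    show "subgroup annihilator (add_monoid FR)"
    proof (rule FR.add.subgroupI)
      show "annihilator \<subseteq> carrier FR" "annihilator \<noteq> {}"
        using sub zero by auto
      show "\<ominus>\<^bsub>FR\<^esub> a \<in> annihilator" if "a \<in> annihilator" for a
        using neg[OF that] inv sub that by auto
      show "a \<oplus>\<^bsub>FR\<^esub> b \<in> annihilator" if "a \<in> annihilator" "b \<in> annihilator" for a b
        using add[OF that] by simp
    qed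
  qed (simp_all add: mult)
qed

lemma annihilates_if_bas:
  assumes "a \<in> carrier FR" "\<And>m m'. m \<in> L \<Longrightarrow> m' \<in> L \<Longrightarrow> \<rho> a (tens (bas m) (bas m')) = 0"
  shows "a \<in> annihilator"
  unfolding annihilator_def
proof (intro CollectI conjI ballI)
  fix v assume "v \<in> WW2"
  hence *: "k \<in> L \<times> L" if "k \<in> Poly_Mapping.keys v" for k
    using that by (auto simp: WW_def)
  show "\<rho> a v = 0"
    by (rule linmap_eqI_on[OF linmap_rep2_right, where T = "\<lambda>_. 0"])
      (use * assms(2) in \<open>force intro: linmapI\<close>)+
qed fact

text \<open>
  In the commutator of \<open>e_i\<close> and \<open>f_j\<close> the mixed terms are \<open>e_i k_j^(-1) \<otimes> k_i f_j\<close> and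
  \<open>k_j^(-1) e_i \<otimes> f_j k_i\<close>; moving the \<open>k\<close>s past the other generators costs \<open>D j i\<close> in one factor and
  the inverse of \<open>D i j\<close> in the other, and \<open>D\<close> is symmetric, so they cancel. What remains is the relation in each factor, and the
  two commutators telescope to \<open>k_i \<otimes> k_i - k_i^(-1) \<otimes> k_i^(-1)\<close>.
\<close>
lemma UB_rels_annihilate: "UB_rels n \<epsilon> \<subseteq> annihilator"
proof -
  note carr = free_ring_closed free_ring_closed' gvar_carrier one_carrier
  note simps = rho_left rho_right rho_mult rho_gen_tens act_k act_k_ef tens_bilinear lin_ext_simps
  \<comment> \<open>Tensors of basis vectors and actions of generators stay symbolic, so that only the relations
    rewrite them.\<close>
  note [simp del] = tens_bas smul_single lin_ext_bas rep_ket.simps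
  have [simp]: "inverse a * inverse b * (a * b) = 1" "a * b * (inverse a * inverse b) = 1"
    if "a \<noteq> 0" "b \<noteq> 0" for a b :: scalar
    using that by (simp_all add: field_simps)
  have "gk i * gkinv i - 1 \<in> annihilator" if "i \<le> n" for i
    by (rule annihilates_if_bas; (intro carr)?) (use that in \<open>simp_all add: simps \<close>)
  moreover have "gkinv i * gk i - 1 \<in> annihilator" if "i \<le> n" for i
    by (rule annihilates_if_bas; (intro carr)?) (use that in \<open>simp_all add: simps \<close>)
  moreover have "gk i * gk j - gk j * gk i \<in> annihilator" if "i \<le> n" "j \<le> n" for i j
    by (rule annihilates_if_bas; (intro carr)?) (use that in \<open>simp_all add: simps mult_ac \<close>)
  moreover have "gk i * ge j - smul (D i j) (ge j * gk i) \<in> annihilator" if "i \<le> n" "j \<le> n" for i j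
    by (rule annihilates_if_bas; (intro carr)?) (use that in \<open>simp_all add: simps algebra_simps \<close>)
  moreover have "gk i * gf j - smul (inverse (D i j)) (gf j * gk i) \<in> annihilator" if "i \<le> n" "j \<le> n" for i j
    by (rule annihilates_if_bas; (intro carr)?) (use that in \<open>simp_all add: simps algebra_simps \<close>)
  moreover have "ge i * gf j - gf j * ge i
        - smul (of_bool (i = j) / (ri n i - inverse (ri n i))) (gk i - gkinv i) \<in> annihilator"
    if "i \<le> n" "j \<le> n" for i j
  proof (rule annihilates_if_bas)
    fix m m' assume m: "m \<in> L" "m' \<in> L"
    define c where "c = of_bool (i = j) / (ri n i - inverse (ri n i))"
    have c: "c = 0 \<or> i = j" by (simp add: c_def)
    note ef = act_ef[OF m(1) that xvar_nonzero, folded c_def] act_ef[OF m(2) that yvar_nonzero, folded c_def]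
    show "\<rho> (ge i * gf j - gf j * ge i
        - smul (of_bool (i = j) / (ri n i - inverse (ri n i))) (gk i - gkinv i)) (tens (bas m) (bas m')) = 0"
      unfolding c_def[symmetric]
    proof (cases "i = j")
      case True
      show "\<rho> (ge i * gf j - gf j * ge i - smul c (gk i - gkinv i)) (tens (bas m) (bas m')) = 0"
        unfolding True using that m
        by (simp add: simps ef[unfolded True] algebra_simps)
    next
      case False
      thus "\<rho> (ge i * gf j - gf j * ge i - smul c (gk i - gkinv i)) (tens (bas m) (bas m')) = 0"
        using that m c by (simp add: simps ef Dcoef_commute[of j i] algebra_simps)
    qed
  qed (intro carr; use that in simp)
  ultimately show ?thesis unfolding UB_rels_def by blast
qed

lemma ideal_I: "ideal RelI FR"
  using UB_rels_annihilate
  by (intro ring.genideal_ideal ring_free_ring) (auto simp: annihilator_def)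

lemma I_annihilates: "a \<in> RelI \<Longrightarrow> v \<in> WW2 \<Longrightarrow> \<rho> a v = 0"
  using ring.genideal_minimal[OF ring_free_ring annihilator_ideal UB_rels_annihilate]
  by (auto simp: annihilator_def)

lemma UB_carrier: "carrier (UB n \<epsilon>) = (\<lambda>a. RelI +>\<^bsub>FR\<^esub> a) ` carrier FR"
  by (auto simp: UB_def FactRing_def A_RCOSETS_defs a_r_coset_def)

text \<open>
  The elements of a coset act in the same way, so \<open>the_elem\<close> is applied to a singleton.
\<close>
lemma WW_action_coset:
  assumes "v \<in> WW2"
  shows "WW_action \<kappa> \<kappa>' (RelI +>\<^bsub>FR\<^esub> a) v = \<rho> a v"
proof -
  have "0 \<in> RelI" using additive_subgroup.zero_closed[OF ideal.axioms(1)[OF ideal_I]] by simp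
  moreover have "RelI +>\<^bsub>FR\<^esub> a = (\<lambda>b. b + a) ` RelI"
    by (auto simp: a_r_coset_def r_coset_def)
  ultimately have "(\<lambda>b. \<rho> b v) ` (RelI +>\<^bsub>FR\<^esub> a) = {\<rho> a v}"
    using I_annihilates[OF _ assms] by (auto simp: rho_left image_image)
  thus ?thesis by (simp add: WW_action_def)
qed

lemma WW_left_module: "left_module (UB n \<epsilon>) WW2 (WW_action \<kappa> \<kappa>')"
proof -
  interpret I: ideal RelI FR by (rule ideal_I)
  have hom: "(RelI +>\<^bsub>FR\<^esub> a) \<oplus>\<^bsub>UB n \<epsilon>\<^esub> (RelI +>\<^bsub>FR\<^esub> b) = RelI +>\<^bsub>FR\<^esub> (a + b)"
    "(RelI +>\<^bsub>FR\<^esub> a) \<otimes>\<^bsub>UB n \<epsilon>\<^esub> (RelI +>\<^bsub>FR\<^esub> b) = RelI +>\<^bsub>FR\<^esub> (a * b)"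
    if "a \<in> carrier FR" "b \<in> carrier FR" for a b
    using ring_hom_add[OF I.rcos_ring_hom that] ring_hom_mult[OF I.rcos_ring_hom that]
    by (simp_all add: UB_def)
  have one: "\<one>\<^bsub>UB n \<epsilon>\<^esub> = RelI +>\<^bsub>FR\<^esub> 1"
    using ring_hom_one[OF I.rcos_ring_hom] by (simp add: UB_def)
  have "ring (UB n \<epsilon>)" unfolding UB_def by (rule I.quotient_is_ring)
  thus ?thesis
    unfolding left_module_def UB_carrier
    by (auto simp: hom one WW_action_coset WW_closed rep2_WW rho_left rho_right rho_mult)
qed

lemma submodule_iff:
  "left_submodule (UB n \<epsilon>) WW2 (WW_action \<kappa> \<kappa>') N \<longleftrightarrow>
     N \<subseteq> WW2 \<and> 0 \<in> N \<and> (\<forall>v\<in>N. \<forall>w\<in>N. v + w \<in> N) \<and> (\<forall>v\<in>N. - v \<in> N)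
   \<and> (\<forall>a\<in>carrier FR. \<forall>v\<in>N. \<rho> a v \<in> N)"
  unfolding left_submodule_def UB_carrier using WW_action_coset by (auto simp: subset_iff)

end

section \<open>Generators on basis vectors\<close>

context chain begin

lemma n_ge: "1 < n" "\<kappa> < n" using n_def kappa_pos kappa'_pos by auto

lemma L_iff: "m \<in> L \<longleftrightarrow>
    (\<forall>l. 0 \<le> m l \<and> (l \<le> \<kappa> \<longrightarrow> m l \<le> 1) \<and> (l \<notin> {1..n} \<longrightarrow> m l = 0))"
  unfolding n_def by (rule labels_iff)

abbreviation "ket2 m m' \<equiv> tens (ket1 m) (ket1 m')"

lemma rho_e_ket2:
  assumes "i \<le> n" "m \<in> L" "m' \<in> L"
  shows "\<rho> (ge i) (ket2 m m') = smul (ecoef xvar i m * kv i m') (ket2 (m + sh i) m')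
     + smul (ecoef yvar i m') (ket2 m (m' + sh i))"
  using assms
  by (simp add: rho_gen_tens act_e_ket act_k_ket tens_bilinear mult_ac del: ket_label ket_nonlabel)

lemma rho_f_ket2:
  assumes "i \<le> n" "m \<in> L" "m' \<in> L"
  shows "\<rho> (gf i) (ket2 m m') = smul (fcoef n xvar i m) (ket2 (m - sh i) m')
     + smul (inverse (kv i m) * fcoef n yvar i m') (ket2 m (m' - sh i))"
  using assms
  by (simp add: rho_gen_tens act_f_ket act_kinv_ket tens_bilinear mult_ac del: ket_label ket_nonlabel)

lemma lookup_ket2:
  "m\<^sub>1 \<in> L \<Longrightarrow> m\<^sub>1' \<in> L \<Longrightarrow>
     Poly_Mapping.lookup (ket2 m m') (m\<^sub>1, m\<^sub>1') = (if (m, m') = (m\<^sub>1, m\<^sub>1') then 1 else 0)"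
  by (auto simp: ket_def lookup_single)

text \<open>
  Both \<open>e_i\<close> and, on vectors supported at site \<open>n\<close>, the word \<open>f_0 ... f_(n-1)\<close> change the label of one
  of the two factors by a fixed amount. Read coefficientwise, the vanishing of \<open>T v\<close> becomes a relation between two
  coefficients of \<open>v\<close>.
\<close>
lemma lookup_two_term:
  assumes "linmap T"
    and T: "\<And>m m'. (m, m') \<in> Poly_Mapping.keys v \<Longrightarrow>
       T (bas (m, m')) = smul (\<alpha> m m') (ket2 (m + s) m') + smul (\<beta> m m') (ket2 m (m' + s))"
    and L: "m\<^sub>1 \<in> L" "m\<^sub>1' \<in> L"
  shows "Poly_Mapping.lookup (T v) (m\<^sub>1, m\<^sub>1') =
     \<alpha> (m\<^sub>1 - s) m\<^sub>1' * Poly_Mapping.lookup v (m\<^sub>1 - s, m\<^sub>1')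
   + \<beta> m\<^sub>1 (m\<^sub>1' - s) * Poly_Mapping.lookup v (m\<^sub>1, m\<^sub>1' - s)"
proof -
  let ?c = "Poly_Mapping.lookup v" and ?K = "Poly_Mapping.keys v"
  have term_eq: "?c k * Poly_Mapping.lookup (T (bas k)) (m\<^sub>1, m\<^sub>1') =
      (if k = (m\<^sub>1 - s, m\<^sub>1') then ?c k * \<alpha> (fst k) (snd k) else 0)
    + (if k = (m\<^sub>1, m\<^sub>1' - s) then ?c k * \<beta> (fst k) (snd k) else 0)" if "k \<in> ?K" for k
  proof (cases k)
    case (Pair m m')
    have "m + s = m\<^sub>1 \<longleftrightarrow> m = m\<^sub>1 - s" "m' + s = m\<^sub>1' \<longleftrightarrow> m' = m\<^sub>1' - s"
      by (auto simp: algebra_simps)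
    thus ?thesis using T[of m m'] that L unfolding Pair
      by (simp add: lookup_add lookup_ket2 algebra_simps del: lookup_tens ket_nonlabel)
  qed
  have "T v = (\<Sum>k\<in>?K. smul (?c k) (T (bas k)))"
    by (subst bas_expansion) (simp only: linmap_simps[OF assms(1)])
  hence "Poly_Mapping.lookup (T v) (m\<^sub>1, m\<^sub>1') = (\<Sum>k\<in>?K. ?c k * Poly_Mapping.lookup (T (bas k)) (m\<^sub>1, m\<^sub>1'))"
    by (simp only: lookup_sum lookup_smul)
  also have "\<dots> = (\<Sum>k\<in>?K. (if k = (m\<^sub>1 - s, m\<^sub>1') then ?c k * \<alpha> (fst k) (snd k) else 0)
    + (if k = (m\<^sub>1, m\<^sub>1' - s) then ?c k * \<beta> (fst k) (snd k) else 0))"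
    using term_eq by (intro sum.cong) auto
  also have "\<dots> = ?c (m\<^sub>1 - s, m\<^sub>1') * \<alpha> (m\<^sub>1 - s) m\<^sub>1' + ?c (m\<^sub>1, m\<^sub>1' - s) * \<beta> m\<^sub>1 (m\<^sub>1' - s)"
    by (simp add: sum.distrib in_keys_iff)
  finally show ?thesis by (simp only: mult.commute)
qed

lemma WW2_keys: "v \<in> WW2 \<Longrightarrow> (m, m') \<in> Poly_Mapping.keys v \<Longrightarrow> m \<in> L \<and> m' \<in> L"
  by (auto simp: WW_def)

lemma lookup_nonlabel: "v \<in> WW2 \<Longrightarrow> m \<notin> L \<or> m' \<notin> L \<Longrightarrow> Poly_Mapping.lookup v (m, m') = 0"
  using WW2_keys[of v m m'] by (auto simp: in_keys_iff)

lemma lookup_rho_e: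
  assumes "v \<in> WW2" "i \<le> n" "m\<^sub>1 \<in> L" "m\<^sub>1' \<in> L"
  shows "Poly_Mapping.lookup (\<rho> (ge i) v) (m\<^sub>1, m\<^sub>1') =
     ecoef xvar i (m\<^sub>1 - sh i) * kv i m\<^sub>1' * Poly_Mapping.lookup v (m\<^sub>1 - sh i, m\<^sub>1')
   + ecoef yvar i (m\<^sub>1' - sh i) * Poly_Mapping.lookup v (m\<^sub>1, m\<^sub>1' - sh i)"
proof (rule lookup_two_term[OF linmap_rep2_right _ assms(3,4)])
  fix m m' assume "(m, m') \<in> Poly_Mapping.keys v"
  from WW2_keys[OF assms(1) this] rho_e_ket2[OF assms(2), of m m']
  show "\<rho> (ge i) (bas (m, m')) = smul (ecoef xvar i m * kv i m') (ket2 (m + sh i) m')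
     + smul (ecoef yvar i m') (ket2 m (m' + sh i))"
    by (simp del: ket_nonlabel)
qed

section \<open>Combinatorics of labels\<close>

text \<open>
  The number of generators \<open>f_1,...,f_n\<close> needed to build the configuration from the vacuum: a particle
  enters at site \<open>n\<close> and takes \<open>n - i\<close> further steps to site \<open>i\<close>.
\<close>
definition height :: "label \<Rightarrow> int" where
  "height m = (\<Sum>i=1..n. int (n + 1 - i) * m i)"

lemma height_plus: "height (m + m') = height m + height m'"
  and height_minus: "height (m - m') = height m - height m'"
  by (simp_all add: height_def algebra_simps sum.distrib sum_subtractf)

lemma height_nonneg: "m \<in> L \<Longrightarrow> height m \<ge> 0"
  unfolding height_def by (intro sum_nonneg mult_nonneg_nonneg) (auto simp: L_iff)

lemma height_sh:
  assumes "1 \<le> i" "i \<le> n"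
  shows "height (sh i) = - 1"
proof -
  have "height (sh i) = (\<Sum>l=1..n. (if l = i + 1 then int (n + 1 - l) else 0) - (if l = i then int (n + 1 - l) else 0))"
    unfolding height_def by (intro sum.cong) (auto simp: shift_def)
  also have "\<dots> = - 1"
    using assms by (auto simp: sum_subtractf)
  finally show ?thesis .
qed

definition site :: "int \<Rightarrow> label" where
  "site a = (\<lambda>l. if l = n then a else 0)"

lemma site_label [simp]: "site a \<in> L \<longleftrightarrow> a \<ge> 0"
proof
  assume "a \<ge> 0"
  thus "site a \<in> L" using n_ge by (simp add: L_iff site_def)
next
  assume "site a \<in> L"
  hence "0 \<le> site a n" by (simp only: L_iff)
  thus "a \<ge> 0" by (simp add: site_def)
qed

lemma site_0: "site 0 = 0"
  by (auto simp: site_def)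

lemma eq_site_iff:
  assumes "m \<in> L"
  shows "m = site (m n) \<longleftrightarrow> (\<forall>l<n. m l = 0)"
proof
  assume "m = site (m n)"
  thus "\<forall>l<n. m l = 0" by (metis site_def less_irrefl)
next
  assume below: "\<forall>l<n. m l = 0"
  show "m = site (m n)"
  proof
    fix l
    have "n < l \<Longrightarrow> m l = 0" using assms by (auto simp: L_iff)
    thus "m l = site (m n) l" using below by (cases l n rule: linorder_cases) (auto simp: site_def)
  qed
qed

lemma zero_label [simp]: "0 \<in> L"
  by (simp add: L_iff)

text \<open>
  The rightmost particle among the sites up to \<open>b\<close> can move on, or leave if it is at site \<open>n\<close>. If its target \<open>i + 1\<close> holds at most one particle, then
  \<open>i + 1 \<le> \<kappa> \<le> b\<close>, and the target is empty by the choice of \<open>i\<close>. Taking \<open>b = n - 1\<close> avoids \<open>e_n\<close>, which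
  would remove the particle.
\<close>
lemma exists_step:
  assumes "m \<in> L" "\<kappa> \<le> b" "b \<le> n" "l \<le> b" "m l \<noteq> 0"
  obtains i where "1 \<le> i" "i \<le> b" "m + sh i \<in> L" "m i \<ge> 1"
proof -
  let ?S = "{l. l \<le> b \<and> m l \<noteq> 0}"
  define i where "i = Max ?S"
  have "i \<in> ?S" unfolding i_def using assms by (intro Max_in) auto
  hence i: "i \<le> b" "m i \<noteq> 0" by auto
  have "0 \<le> m i" "i \<notin> {1..n} \<Longrightarrow> m i = 0" using assms(1) by (auto simp: L_iff)
  with i have i1: "1 \<le> i" "m i \<ge> 1" by (cases "i = 0"; simp)+
  have "m (i + 1) = 0" if "i < \<kappa>"
  proof (rule ccontr)
    assume "m (i + 1) \<noteq> 0"
    hence "i + 1 \<le> i" unfolding i_def using that assms(2) 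
      by (intro Max_ge) (auto simp: i_def[symmetric])
    thus False by simp
  qed
  hence "m + sh i \<in> L" using plus_sh_label_iff[OF assms(1), of i] i i1 assms(3) by auto
  thus thesis using that i i1 by blast
qed

lemma exists_step_nonzero:
  assumes "m \<in> L" "m \<noteq> 0"
  obtains i where "1 \<le> i" "i \<le> n" "m + sh i \<in> L" "m i \<ge> 1"
proof -
  obtain l where "m l \<noteq> 0" using assms(2) by (auto simp: fun_eq_iff)
  moreover from this have "l \<le> n" using assms(1) by (force simp: L_iff)
  ultimately show thesis using that exists_step[OF assms(1), of n l] n_ge by auto
qed

section \<open>Singular vectors\<close>

text \<open>
  Let \<open>m\<close> be nonzero and let \<open>e_i\<close> act on it. Comparing coefficients of \<open>e_i v = 0\<close> at \<open>(m + sh i, m')\<close>, the contribution of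
  \<open>(m, m')\<close> has to be cancelled by that of \<open>(m + sh i, m' - sh i)\<close>, which has the same total
  label and a left factor of smaller height. Induction on this height empties the left factor.
\<close>
lemma singular_keys_left_vacuum:
  assumes "v \<in> WW2" and sing: "\<And>i. 1 \<le> i \<Longrightarrow> i \<le> n \<Longrightarrow> \<rho> (ge i) v = 0"
  shows "(m, m') \<in> Poly_Mapping.keys v \<Longrightarrow> (0, m + m') \<in> Poly_Mapping.keys v"
proof (induction "nat (height m)" arbitrary: m m' rule: less_induct)
  case less
  note L = WW2_keys[OF assms(1) less.prems]
  show ?case
  proof (cases "m = 0")
    case True
    thus ?thesis using less.prems by simp
  next
    case False
    with L obtain i where i: "1 \<le> i" "i \<le> n" "m + sh i \<in> L" "m i \<ge> 1"
      by (auto elim: exists_step_nonzero)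
    have "0 = ecoef xvar i m * kv i m' * Poly_Mapping.lookup v (m, m')
        + ecoef yvar i (m' - sh i) * Poly_Mapping.lookup v (m + sh i, m' - sh i)"
      using lookup_rho_e[OF assms(1) i(2,3), of m'] L sing[OF i(1,2)] by simp
    moreover have "ecoef xvar i m \<noteq> 0" using i qnum_nonzero[of "m i"] by (simp add: ecoef_def)
    ultimately have "(m + sh i, m' - sh i) \<in> Poly_Mapping.keys v"
      using less.prems by (auto simp: in_keys_iff)
    moreover from this have "nat (height (m + sh i)) < nat (height m)"
      using height_nonneg[of "m + sh i"] i by (simp add: height_plus height_sh)
    ultimately have "(0, (m + sh i) + (m' - sh i)) \<in> Poly_Mapping.keys v"
      by (intro less.hyps)
    thus ?thesis by (simp add: algebra_simps)
  qed
qed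

text \<open>
  With the left factor empty, a particle of the right factor at some site before \<open>n\<close> could be moved by
  some \<open>e_i\<close> with \<open>i < n\<close>, and nothing could cancel the result: the only other contribution would
  come from the left label \<open>- sh i\<close>, which is not one. So the total label, and with it both labels, is
  concentrated at site \<open>n\<close>.
\<close>
lemma singular_keys:
  assumes "v \<in> WW2" and sing: "\<And>i. 1 \<le> i \<Longrightarrow> i \<le> n \<Longrightarrow> \<rho> (ge i) v = 0"
    and k: "(m, m') \<in> Poly_Mapping.keys v"
  shows "m = site (m n)" "m' = site (m' n)"
proof -
  note L = WW2_keys[OF assms(1) k]
  have k0: "(0, m + m') \<in> Poly_Mapping.keys v"
    using singular_keys_left_vacuum[OF assms] .
  note L0 = WW2_keys[OF assms(1) k0]
  have zero: "(m + m') l = 0" if "l < n" for l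
  proof (rule ccontr)
    assume "(m + m') l \<noteq> 0"
    moreover have "\<kappa> \<le> n - 1" "n - 1 \<le> n" "l \<le> n - 1" using n_ge that by auto
    ultimately obtain i where i: "1 \<le> i" "i \<le> n - 1" "m + m' + sh i \<in> L" "(m + m') i \<ge> 1"
      using L0 exists_step[of "m + m'" "n - 1" l] by blast
    have i_n: "i < n" "i \<le> n" using i that by auto
    have "(0 - sh i) (i + 1) = - 1" using i_n by (simp add: shift_def)
    hence "0 - sh i \<notin> L" unfolding L_iff by (metis neg_0_le_iff_le not_one_le_zero)
    hence "Poly_Mapping.lookup v (0 - sh i, m + m' + sh i) = 0"
      by (intro lookup_nonlabel assms) auto
    hence "ecoef yvar i (m + m') * Poly_Mapping.lookup v (0, m + m') = 0"
      using lookup_rho_e[OF assms(1) i_n(2) zero_label i(3)] sing[OF i(1) i_n(2)] by simp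
    moreover have "ecoef yvar i (m + m') \<noteq> 0"
      using i qnum_nonzero[of "(m + m') i"] by (simp add: ecoef_def)
    ultimately show False using k0 by (simp add: in_keys_iff)
  qed
  have nonneg: "0 \<le> m l" "0 \<le> m' l" for l using L by (auto simp: L_iff)
  have "m l = 0" "m' l = 0" if "l < n" for l using zero[OF that] nonneg[of l] by auto
  thus "m = site (m n)" "m' = site (m' n)" using L by (simp_all add: eq_site_iff)
qed

section \<open>Reduction to the last site\<close>

lemma site_ee_label: "a \<ge> 0 \<Longrightarrow> 1 \<le> j \<Longrightarrow> j < n \<Longrightarrow> site a + ee j \<in> L"
  "a < 0 \<Longrightarrow> j < n \<Longrightarrow> site a + ee j \<notin> L"
proof -
  show "site a + ee j \<in> L" if "a \<ge> 0" "1 \<le> j" "j < n"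
    using n_ge that unfolding L_iff by (auto simp: site_def ee_def)
  assume *: "a < 0" "j < n"
  hence "(site a + ee j) n < 0" by (simp add: site_def ee_def)
  thus "site a + ee j \<notin> L" unfolding L_iff by (metis not_less)
qed

lemma kval_site:
  "0 < j \<Longrightarrow> j < n - 1 \<Longrightarrow> kv j (site b) = 1"
  "kv (n - 1) (site b) = qpar powi b"
  "kv 0 (site b) = inverse ppar"
  "kv n (site b) = ppar * qpar powi (- b)"
proof -
  have "n - 1 < n" "n - 1 \<noteq> 0" "n - 1 + 1 = n" using n_ge by auto
  thus "0 < j \<Longrightarrow> j < n - 1 \<Longrightarrow> kv j (site b) = 1"
  "kv (n - 1) (site b) = qpar powi b"
  "kv 0 (site b) = inverse ppar"
  "kv n (site b) = ppar * qpar powi (- b)"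
    using n_ge by (auto simp: kval_def site_def qi_def eps_def simp flip: n_def)
qed

text \<open>
  In a configuration supported at site \<open>n\<close>, apart from one particle in transit, \<open>f_j\<close> can only move
  that particle: in the other factor site \<open>j + 1\<close> is empty, and there \<open>k_j\<close> acts trivially.
\<close>
lemma rho_f_move:
  assumes "1 \<le> j" "j < n - 1" "b \<ge> 0"
  shows "\<rho> (gf j) (ket2 (site c + ee (Suc j)) (site b)) = ket2 (site c + ee j) (site b)"
    "\<rho> (gf j) (ket2 (site b) (site c + ee (Suc j))) = ket2 (site b) (site c + ee j)"
proof -
  have j: "j < n" "j \<le> n" "j + 1 < n" using assms by auto
  have eq: "site c + ee (Suc j) - sh j = site c + ee j"
    using assms by (auto simp: fun_eq_iff ee_def shift_def)
  have coefs: "fcoef n z j (site b) = 0" "fcoef n z j (site c + ee (Suc j)) = 1" for z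
    using j assms by (simp_all add: fcoef_def site_def ee_def)
  have "\<rho> (gf j) (ket2 (site c + ee (Suc j)) (site b)) = ket2 (site c + ee j) (site b)
    \<and> \<rho> (gf j) (ket2 (site b) (site c + ee (Suc j))) = ket2 (site b) (site c + ee j)"
  proof (cases "c \<ge> 0")
    case True
    hence L: "site c + ee (Suc j) \<in> L" "site b \<in> L"
      using assms j by (auto intro: site_ee_label)
    have "\<rho> (gf j) (ket2 (site c + ee (Suc j)) (site b)) = ket2 (site c + ee j) (site b)"
      unfolding rho_f_ket2[OF j(2) L] eq coefs by simp
    moreover have "\<rho> (gf j) (ket2 (site b) (site c + ee (Suc j))) = ket2 (site b) (site c + ee j)"
      unfolding rho_f_ket2[OF j(2) L(2,1)] eq coefs using kval_site(1)[of j b] assms by simp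
    ultimately show ?thesis by blast
  next
    case False
    hence "site c + ee (Suc j) \<notin> L" "site c + ee j \<notin> L"
      using j by (simp_all add: site_ee_label)
    thus ?thesis
      by (simp add: rho_right)
  qed
  thus "\<rho> (gf j) (ket2 (site c + ee (Suc j)) (site b)) = ket2 (site c + ee j) (site b)"
      "\<rho> (gf j) (ket2 (site b) (site c + ee (Suc j))) = ket2 (site b) (site c + ee j)"
    by blast+
qed

text \<open>
  The particle is picked up by \<open>f_(n-1)\<close>, which accounts for the q-numbers and for the power of \<open>q\<close>,
  the eigenvalue of the inverse of \<open>k_(n-1)\<close> on the left factor; all later moves have coefficient \<open>1\<close>.
\<close>
lemma rho_f_word:
  assumes "a \<ge> 0" "b \<ge> 0" "1 \<le> j" "j < n"
  shows "\<rho> (prod_list (map gf [j..<n])) (ket2 (site a) (site b)) =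
     smul (qnum a) (ket2 (site (a - 1) + ee j) (site b))
   + smul (qpar powi (- a) * qnum b) (ket2 (site a) (site (b - 1) + ee j))"
  using \<open>1 \<le> j\<close> \<open>j < n\<close>
proof (induction "n - 1 - j" arbitrary: j)
  case 0
  hence j: "j = n - 1" by simp
  have upt: "[j..<n] = [n - 1]" using n_ge j by (cases n) auto
  have eq: "site c - sh (n - 1) = site (c - 1) + ee (n - 1)" for c
    using n_ge by (auto simp: fun_eq_iff ee_def shift_def site_def)
  have coefs: "fcoef n z (n - 1) (site c) = qnum c" for z c
    using n_ge by (simp add: fcoef_def site_def)
  have L: "n - 1 \<le> n" "site a \<in> L" "site b \<in> L" using assms by simp_all
  have word: "prod_list (map gf [j..<n]) = gf (n - 1)" unfolding upt by simp
  show ?case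
    unfolding word rho_f_ket2[OF L] coefs eq kval_site(2) power_int_minus unfolding j by (rule refl)
next
  case (Suc d)
  have upt: "[j..<n] = j # [Suc j..<n]" using Suc.prems upt_conv_Cons by simp
  have "\<rho> (prod_list (map gf [Suc j..<n])) (ket2 (site a) (site b)) =
     smul (qnum a) (ket2 (site (a - 1) + ee (Suc j)) (site b))
   + smul (qpar powi (- a) * qnum b) (ket2 (site a) (site (b - 1) + ee (Suc j)))"
    using Suc.hyps(2) by (intro Suc.hyps(1)) auto
  moreover have "j < n - 1" using Suc.hyps(2) by auto
  ultimately show ?case using assms Suc.prems unfolding upt
    by (simp add: rho_mult rho_right rho_f_move del: ket_label ket_nonlabel upt_Suc)
qed

text \<open>
  A second annihilation operator at site \<open>n\<close>, besides \<open>e_n\<close>: the particle leaves at the other end of the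
  chain, where the spectral parameter enters.
\<close>
definition lower_word :: free_alg where "lower_word = prod_list (map gf [0..<n])"

lemma rho_lower_word:
  assumes "a \<ge> 0" "b \<ge> 0"
  shows "\<rho> lower_word (ket2 (site a) (site b)) =
     smul (inverse xvar * qnum a) (ket2 (site (a - 1)) (site b))
   + smul (inverse yvar * ppar * qpar powi (- a) * qnum b) (ket2 (site a) (site (b - 1)))"
proof -
  have upt: "[0..<n] = 0 # [Suc 0..<n]" using n_ge upt_conv_Cons by simp
  have eq: "site c + ee (Suc 0) - sh 0 = site c" for c
    using n_ge by (auto simp: fun_eq_iff ee_def shift_def site_def)
  have coefs: "fcoef n z 0 (site c) = 0" "fcoef n z 0 (site c + ee (Suc 0)) = inverse z" for z c
    using n_ge by (simp_all add: fcoef_def site_def ee_def)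
  have gf_0: "\<rho> (gf 0) (ket2 (site c + ee (Suc 0)) (site b)) = smul (inverse xvar) (ket2 (site c) (site b))"
    "\<rho> (gf 0) (ket2 (site a) (site c + ee (Suc 0))) = smul (ppar * inverse yvar) (ket2 (site a) (site c))" for c
  proof -
    have "\<rho> (gf 0) (ket2 (site c + ee (Suc 0)) (site b)) = smul (inverse xvar) (ket2 (site c) (site b))
      \<and> \<rho> (gf 0) (ket2 (site a) (site c + ee (Suc 0))) = smul (ppar * inverse yvar) (ket2 (site a) (site c))"
    proof (cases "c \<ge> 0")
      case True
      hence L: "site c + ee (Suc 0) \<in> L" "site b \<in> L" "site a \<in> L"
        using assms n_ge by (auto intro: site_ee_label)
      have "\<rho> (gf 0) (ket2 (site c + ee (Suc 0)) (site b)) = smul (inverse xvar) (ket2 (site c) (site b))"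
        unfolding rho_f_ket2[OF le0 L(1,2)] eq coefs by simp
      moreover have "\<rho> (gf 0) (ket2 (site a) (site c + ee (Suc 0))) = smul (ppar * inverse yvar) (ket2 (site a) (site c))"
        unfolding rho_f_ket2[OF le0 L(3,1)] eq coefs kval_site by simp
      ultimately show ?thesis by blast
    next
      case False
      hence "site c + ee (Suc 0) \<notin> L" "site c \<notin> L"
        using n_ge by (simp_all add: site_ee_label)
      thus ?thesis
        by (simp add: rho_right)
    qed
    thus "\<rho> (gf 0) (ket2 (site c + ee (Suc 0)) (site b)) = smul (inverse xvar) (ket2 (site c) (site b))"
      "\<rho> (gf 0) (ket2 (site a) (site c + ee (Suc 0))) = smul (ppar * inverse yvar) (ket2 (site a) (site c))"
      by blast+
  qed
  show ?thesis
    unfolding lower_word_def upt using rho_f_word[OF assms, of "Suc 0"] n_ge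
    by (simp add: rho_mult rho_right gf_0 mult_ac del: ket_label ket_nonlabel upt_Suc)
qed

lemma rho_e_move:
  assumes "1 \<le> j" "j < n" "a \<ge> 0" "b \<ge> 0"
  shows "\<rho> (ge j) (ket2 (site a) (site b + ee j)) = ket2 (site a) (site b + ee (Suc j))"
    "\<rho> (ge j) (ket2 (site a + ee j) (site b)) = smul (kv j (site b)) (ket2 (site a + ee (Suc j)) (site b))"
proof -
  have eq: "site c + ee j + sh j = site c + ee (Suc j)" for c
    using assms by (auto simp: fun_eq_iff ee_def shift_def)
  have coefs: "ecoef z j (site c) = 0" "ecoef z j (site c + ee j) = 1" for z c
    using assms by (simp_all add: ecoef_def site_def ee_def)
  show "\<rho> (ge j) (ket2 (site a) (site b + ee j)) = ket2 (site a) (site b + ee (Suc j))"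
    "\<rho> (ge j) (ket2 (site a + ee j) (site b)) = smul (kv j (site b)) (ket2 (site a + ee (Suc j)) (site b))"
    using assms by (simp_all add: rho_e_ket2 coefs eq site_ee_label del: ket_label ket_nonlabel)
qed

lemma rho_e_word:
  assumes "a \<ge> 0" "b \<ge> 0" "j < n - 1"
  shows "\<rho> (prod_list (map ge (rev [0..<Suc j]))) (ket2 (site a) (site b)) =
     smul (xvar * inverse ppar) (ket2 (site a + ee (Suc j)) (site b))
   + smul yvar (ket2 (site a) (site b + ee (Suc j)))"
  using \<open>j < n - 1\<close>
proof (induction j)
  case 0
  have eq: "site c + sh 0 = site c + ee (Suc 0)" for c
    using n_ge by (auto simp: fun_eq_iff ee_def shift_def site_def)
  have L: "site a \<in> L" "site b \<in> L" using assms by simp_all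
  have coef: "ecoef z 0 m = z" for z m by (simp add: ecoef_def)
  have word: "prod_list (map ge (rev [0..<Suc 0])) = ge 0" by simp
  show ?case unfolding word rho_e_ket2[OF le0 L] eq coef kval_site(3) by (rule refl)
next
  case (Suc j)
  have rev: "rev [0..<Suc (Suc j)] = Suc j # rev [0..<Suc j]" by simp
  have IH: "\<rho> (prod_list (map ge (rev [0..<Suc j]))) (ket2 (site a) (site b)) =
     smul (xvar * inverse ppar) (ket2 (site a + ee (Suc j)) (site b))
   + smul yvar (ket2 (site a) (site b + ee (Suc j)))"
    using Suc.prems by (intro Suc.IH) simp
  have j: "1 \<le> Suc j" "Suc j < n" "0 < Suc j" "Suc j < n - 1" using Suc.prems by simp_all
  show ?case
    unfolding rev list.map prod_list.Cons rho_mult IH rho_right rho_e_move[OF j(1,2) assms(1,2)]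
      kval_site(1)[OF j(3,4)] pm.scale_one by (rule refl)
qed

text \<open>
  The creation operator at site \<open>n\<close>, besides \<open>f_n\<close>, that lets the particle enter at site \<open>1\<close>.
\<close>
definition raise_word :: free_alg where "raise_word = prod_list (map ge (rev [0..<n]))"

lemma rho_raise_word:
  assumes "a \<ge> 0" "b \<ge> 0"
  shows "\<rho> raise_word (ket2 (site a) (site b)) =
     smul (xvar * inverse ppar * qpar powi b) (ket2 (site (a + 1)) (site b))
   + smul yvar (ket2 (site a) (site (b + 1)))"
proof -
  obtain j where j: "n = Suc (Suc j)" using n_ge by (metis less_imp_Suc_add add_Suc_shift plus_1_eq_Suc)
  have rev: "rev [0..<n] = (n - 1) # rev [0..<Suc j]" unfolding j by simp
  have eq: "site c + ee n = site (c + 1)" for c by (auto simp: site_def ee_def)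
  have Suc_n: "Suc (n - 1) = n" using n_ge by simp
  have m: "\<rho> (ge (n - 1)) (ket2 (site a) (site b + ee (n - 1))) = ket2 (site a) (site (b + 1))"
    "\<rho> (ge (n - 1)) (ket2 (site a + ee (n - 1)) (site b)) = smul (qpar powi b) (ket2 (site (a + 1)) (site b))"
    using rho_e_move[OF _ _ assms, of "n - 1"] n_ge
    unfolding Suc_n kval_site(2) eq by simp_all
  have "Suc j = n - 1" using j by simp
  hence word: "\<rho> (prod_list (map ge (rev [0..<Suc j]))) (ket2 (site a) (site b)) =
     smul (xvar * inverse ppar) (ket2 (site a + ee (n - 1)) (site b))
   + smul yvar (ket2 (site a) (site b + ee (n - 1)))"
    using rho_e_word[OF assms, of j] by (metis lessI)
  show ?thesis
    unfolding raise_word_def rev list.map prod_list.Cons rho_mult word rho_right m pm.scale_scale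
    by (rule refl)
qed

lemma words_carrier: "lower_word \<in> carrier FR" "raise_word \<in> carrier FR"
proof -
  have closed: "prod_list as \<in> carrier FR" if "\<And>a. a \<in> set as \<Longrightarrow> a \<in> carrier FR" for as
    using that by (induction as) (auto intro: free_ring_closed one_carrier)
  show "lower_word \<in> carrier FR" "raise_word \<in> carrier FR"
    unfolding lower_word_def raise_word_def by (rule closed; auto intro!: gvar_carrier)+
qed


section \<open>Every nonzero submodule contains the vacuum\<close>

text \<open>
  The linear system satisfied by two neighbouring coefficients of a vector killed by \<open>e_n\<close> and by
  \<open>lower_word\<close>. Its determinant is \<open>1/x + q^(- a - b - 1)/y\<close>, because \<open>p\<close> squares to \<open>- 1/q\<close>.
\<close>
lemma lowering_system_regular:
  assumes "a \<ge> 0" "b \<ge> 0"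
    and e: "A * (ppar * qpar powi (- b)) + B = 0"
    and low: "inverse xvar * A + inverse yvar * ppar * qpar powi (- a) * B = 0"
  shows "A = 0" "B = 0"
proof -
  define k where "k = nat (a + b)"
  have k: "qpar powi (- a) * qpar powi (- b) = inverse (qpar ^ k)"
    using assms(1,2) power_int_add[of qpar "- a" "- b"]
    by (simp add: k_def power_int_def nat_add_distrib power_add power_inverse)
  have B: "B = - (A * (ppar * qpar powi (- b)))" using e by (simp add: add_eq_0_iff)
  have "0 = inverse xvar * A - inverse yvar * A * (ppar * ppar) * (qpar powi (- a) * qpar powi (- b))"
    using low unfolding B by (simp add: mult_ac)
  also have "\<dots> = A * (inverse xvar + inverse yvar * inverse qpar * inverse (qpar ^ k))"
    unfolding k ppar_square by (simp add: algebra_simps)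
  also have "inverse xvar + inverse yvar * inverse qpar * inverse (qpar ^ k)
      = (xvar + yvar * qpar ^ Suc k) / (xvar * yvar * qpar ^ Suc k)"
    by (simp add: field_simps)
  finally show "A = 0" using xy_generic(1)[of "Suc k"] by simp
  thus "B = 0" using B by simp
qed

lemma site_add: "site a + site b = site (a + b)"
  by (auto simp: site_def)

lemma sh_n: "sh n = site (- 1)"
  using n_ge by (auto simp: fun_eq_iff shift_def site_def)

lemma site_n [simp]: "site a n = a"
  by (simp add: site_def)

lemma lookup_rho_lower_word:
  assumes "v \<in> WW2" and keys: "\<And>m m'. (m, m') \<in> Poly_Mapping.keys v \<Longrightarrow> m = site (m n) \<and> m' = site (m' n)"
    and L: "m\<^sub>1 \<in> L" "m\<^sub>1' \<in> L"
  shows "Poly_Mapping.lookup (\<rho> lower_word v) (m\<^sub>1, m\<^sub>1') =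
     inverse xvar * qnum ((m\<^sub>1 - sh n) n) * Poly_Mapping.lookup v (m\<^sub>1 - sh n, m\<^sub>1')
   + inverse yvar * ppar * qpar powi (- m\<^sub>1 n) * qnum ((m\<^sub>1' - sh n) n) *
       Poly_Mapping.lookup v (m\<^sub>1, m\<^sub>1' - sh n)"
proof (rule lookup_two_term[OF linmap_rep2_right _ L])
  fix m m' assume k: "(m, m') \<in> Poly_Mapping.keys v"
  obtain a b where m: "m = site a" "m' = site b" using keys[OF k] by blast
  have L: "site a \<in> L" "site b \<in> L" using WW2_keys[OF assms(1) k] m by simp_all
  hence ab: "a \<ge> 0" "b \<ge> 0" by simp_all
  have "bas (m, m') = ket2 (site a) (site b)" using L m by simp
  thus "\<rho> lower_word (bas (m, m')) =
     smul (inverse xvar * qnum (m n)) (ket2 (m + sh n) m')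
   + smul (inverse yvar * ppar * qpar powi (- m n) * qnum (m' n)) (ket2 m (m' + sh n))"
    using rho_lower_word[OF ab] by (simp only: m sh_n site_add site_n) simp
qed

text \<open>
  For every \<open>(a, b)\<close> the preceding system applies to the coefficients at \<open>(a + 1, b)\<close> and \<open>(a, b + 1)\<close>,
  and every pair except the vacuum has one of these forms.
\<close>
lemma lowering_kernel:
  assumes "v \<in> WW2" and keys: "\<And>m m'. (m, m') \<in> Poly_Mapping.keys v \<Longrightarrow> m = site (m n) \<and> m' = site (m' n)"
    and e: "\<rho> (ge n) v = 0" and low: "\<rho> lower_word v = 0"
    and k: "(m, m') \<in> Poly_Mapping.keys v"
  shows "m = 0 \<and> m' = 0"
proof -
  let ?c = "\<lambda>a b. Poly_Mapping.lookup v (site a, site b)"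
  have en: "ecoef z n m = qnum (m n)" for z m using n_ge by (simp add: ecoef_def)
  have rel: "qnum (a + 1) * ?c (a + 1) b = 0" "qnum (b + 1) * ?c a (b + 1) = 0" if ab: "a \<ge> 0" "b \<ge> 0" for a b
  proof -
    have L: "site a \<in> L" "site b \<in> L" using ab by simp_all
    have s: "site a - sh n = site (a + 1)" for a
      unfolding sh_n by (auto simp: site_def)
    have 1: "(qnum (a + 1) * ?c (a + 1) b) * (ppar * qpar powi (- b)) + qnum (b + 1) * ?c a (b + 1) = 0"
      using lookup_rho_e[OF assms(1) order_refl L] unfolding e s en kval_site site_n by (simp add: mult_ac)
    have 2: "inverse xvar * (qnum (a + 1) * ?c (a + 1) b)
        + inverse yvar * ppar * qpar powi (- a) * (qnum (b + 1) * ?c a (b + 1)) = 0"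
      using lookup_rho_lower_word[OF assms(1) keys L] unfolding low s site_n by (simp add: mult_ac)
    show "qnum (a + 1) * ?c (a + 1) b = 0" "qnum (b + 1) * ?c a (b + 1) = 0"
      using lowering_system_regular[OF ab 1 2] by simp_all
  qed
  obtain a b where m: "m = site a" "m' = site b" using keys[OF k] by blast
  have ab: "a \<ge> 0" "b \<ge> 0" using WW2_keys[OF assms(1) k] m by simp_all
  have c: "?c a b \<noteq> 0" using k m by (simp add: in_keys_iff)
  have "a = 0" using rel(1)[of "a - 1" b] qnum_nonzero[of a] ab c by (cases "a = 0") auto
  moreover have "b = 0" using rel(2)[of a "b - 1"] qnum_nonzero[of b] ab c by (cases "b = 0") auto
  ultimately show ?thesis using m by (simp add: site_0)
qed

text \<open>
  Operators of the shape treated in \<open>lookup_two_term\<close> with shift \<open>sh i\<close>, where \<open>1 \<le> i\<close>, lower the heights that occur in a vector.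
  This applies to \<open>lower_word\<close> as well, whose shift is that of \<open>e_n\<close>.
\<close>
lemma keys_two_term:
  assumes "\<And>m\<^sub>1 m\<^sub>1'. m\<^sub>1 \<in> L \<Longrightarrow> m\<^sub>1' \<in> L \<Longrightarrow> Poly_Mapping.lookup w (m\<^sub>1, m\<^sub>1') =
     \<alpha> m\<^sub>1 m\<^sub>1' * Poly_Mapping.lookup v (m\<^sub>1 - sh i, m\<^sub>1')
   + \<beta> m\<^sub>1 m\<^sub>1' * Poly_Mapping.lookup v (m\<^sub>1, m\<^sub>1' - sh i)"
    and "w \<in> WW2" "1 \<le> i" "i \<le> n"
    and v: "\<And>m m'. (m, m') \<in> Poly_Mapping.keys v \<Longrightarrow> height m + height m' < int (Suc d)"
    and k: "(m, m') \<in> Poly_Mapping.keys w"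
  shows "height m + height m' < int d"
proof -
  have L: "m \<in> L" "m' \<in> L" using WW2_keys[OF assms(2) k] by auto
  have "Poly_Mapping.lookup w (m, m') \<noteq> 0" using k by (simp add: in_keys_iff)
  hence "(m - sh i, m') \<in> Poly_Mapping.keys v \<or> (m, m' - sh i) \<in> Poly_Mapping.keys v"
    using assms(1)[OF L] by (auto simp: in_keys_iff)
  thus ?thesis
    using v[of "m - sh i" m'] v[of m "m' - sh i"] height_sh[OF assms(3,4)] by (auto simp: height_minus)
qed

definition submod :: "(label \<times> label \<Rightarrow>\<^sub>0 scalar) set \<Rightarrow> bool" where
  "submod N \<longleftrightarrow> left_submodule (UB n \<epsilon>) WW2 (WW_action \<kappa> \<kappa>') N"

text \<open>
  The scalars belong to the algebra, which makes a submodule a subspace.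
\<close>
lemma submodD:
  assumes "submod N"
  shows "N \<subseteq> WW2" "0 \<in> N" "v \<in> N \<Longrightarrow> w \<in> N \<Longrightarrow> v + w \<in> N" "v \<in> N \<Longrightarrow> - v \<in> N"
    "a \<in> carrier FR \<Longrightarrow> v \<in> N \<Longrightarrow> \<rho> a v \<in> N" "v \<in> N \<Longrightarrow> smul c v \<in> N"
proof -
  show "N \<subseteq> WW2" "0 \<in> N" "v \<in> N \<Longrightarrow> w \<in> N \<Longrightarrow> v + w \<in> N" "v \<in> N \<Longrightarrow> - v \<in> N"
    using assms unfolding submod_def submodule_iff by auto
  have act: "\<And>a v. a \<in> carrier FR \<Longrightarrow> v \<in> N \<Longrightarrow> \<rho> a v \<in> N"
    using assms unfolding submod_def submodule_iff by auto
  show "v \<in> N \<Longrightarrow> smul c v \<in> N"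
    using act[of "smul c 1" v] by (simp add: free_ring_closed' one_carrier rho_left del: smul_single single_one)
  show "a \<in> carrier FR \<Longrightarrow> v \<in> N \<Longrightarrow> \<rho> a v \<in> N" by (rule act)
qed

lemma ge_gf_carrier: "i \<le> n \<Longrightarrow> ge i \<in> carrier FR" "i \<le> n \<Longrightarrow> gf i \<in> carrier FR"
  by (simp_all add: gvar_carrier)

text \<open>
  Among \<open>e_1,...,e_n\<close> and \<open>lower_word\<close> some operator produces a nonzero vector of smaller height as long
  as \<open>v\<close> is not a multiple of the vacuum; \<open>lower_word\<close> is needed only once \<open>v\<close> is singular,
  that is, supported at site \<open>n\<close>.
\<close>
lemma vacuum_in_submodule:
  assumes N: "submod N"
  shows "v \<in> N \<Longrightarrow> v \<noteq> 0 \<Longrightarrow>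
    (\<And>m m'. (m, m') \<in> Poly_Mapping.keys v \<Longrightarrow> height m + height m' < int d) \<Longrightarrow> bas (0, 0) \<in> N"
proof (induction d arbitrary: v)
  case 0
  then obtain m m' where k: "(m, m') \<in> Poly_Mapping.keys v"
    by (metis ex_in_conv keys_eq_empty surj_pair)
  have "m \<in> L" "m' \<in> L" using WW2_keys[OF _ k] 0(1) submodD(1)[OF N] by auto
  hence "height m + height m' \<ge> 0" using height_nonneg by (simp add: add_nonneg_nonneg)
  thus ?case using 0(3)[OF k] by simp
next
  case (Suc d)
  have v: "v \<in> WW2" using Suc.prems(1) submodD(1)[OF N] by auto
  show ?case
  proof (cases "\<forall>i. 1 \<le> i \<and> i \<le> n \<longrightarrow> \<rho> (ge i) v = 0")
    case False
    then obtain i where i: "1 \<le> i" "i \<le> n" "\<rho> (ge i) v \<noteq> 0" by blast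
    show ?thesis
    proof (rule Suc.IH)
      show "\<rho> (ge i) v \<in> N" using submodD(5)[OF N] ge_gf_carrier i Suc.prems(1) by blast
      show "height m + height m' < int d" if "(m, m') \<in> Poly_Mapping.keys (\<rho> (ge i) v)" for m m'
        by (rule keys_two_term[OF lookup_rho_e[OF v i(2)] rep2_WW[OF v] i(1,2) Suc.prems(3) that])
    qed fact
  next
    case True
    have keys: "m = site (m n) \<and> m' = site (m' n)" if "(m, m') \<in> Poly_Mapping.keys v" for m m'
      using singular_keys[OF v _ that] True by blast
    show ?thesis
    proof (cases "\<rho> lower_word v = 0")
      case False
      show ?thesis
      proof (rule Suc.IH)
        show "\<rho> lower_word v \<in> N" using submodD(5)[OF N words_carrier(1)] Suc.prems(1) by blast
        have n: "1 \<le> n" "n \<le> n" using n_ge by auto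
        show "height m + height m' < int d" if "(m, m') \<in> Poly_Mapping.keys (\<rho> lower_word v)" for m m'
          by (rule keys_two_term[OF lookup_rho_lower_word[OF v keys] rep2_WW[OF v] n Suc.prems(3) that])
      qed fact
    next
      case low: True
      have "\<rho> (ge n) v = 0" using True n_ge by auto
      with low have "Poly_Mapping.keys v \<subseteq> {(0, 0)}"
        using lowering_kernel[OF v keys] by auto
      then have "v = smul (Poly_Mapping.lookup v (0, 0)) (bas (0, 0))"
        by (intro poly_mapping_eqI) (auto simp: lookup_single when_def in_keys_iff)
      moreover from this have "Poly_Mapping.lookup v (0, 0) \<noteq> 0" using Suc.prems(2) by auto
      ultimately have "bas (0, 0) = smul (inverse (Poly_Mapping.lookup v (0, 0))) v"
        by (metis pm.scale_scale left_inverse pm.scale_one)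
      thus ?thesis using submodD(6)[OF N Suc.prems(1)] by metis
    qed
  qed
qed

section \<open>The vacuum generates the module\<close>

lemma submod_cancel:
  assumes N: "submod N" and "smul c u + smul d w \<in> N" "w \<in> N" "c \<noteq> 0"
  shows "u \<in> N"
proof -
  have "(smul c u + smul d w) + - smul d w \<in> N"
    using assms submodD[OF N] by blast
  hence "smul c u \<in> N" by simp
  from submodD(6)[OF N this, of "inverse c"] show ?thesis
    using \<open>c \<noteq> 0\<close> by (simp del: smul_single)
qed

text \<open>
  From \<open>(a, b)\<close> the operators \<open>f_n\<close> and \<open>raise_word\<close> give two combinations of the vectors at \<open>(a + 1, b)\<close> and
  \<open>(a, b + 1)\<close>. Up to sign, their determinant is \<open>y + x q^(a + b + 1)\<close>, so both vectors belong to \<open>N\<close>.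
\<close>
lemma last_site_in_submodule:
  assumes N: "submod N" and vac: "bas (0, 0) \<in> N"
  shows "a \<ge> 0 \<Longrightarrow> b \<ge> 0 \<Longrightarrow> ket2 (site a) (site b) \<in> N"
proof (induction "nat (a + b)" arbitrary: a b)
  case 0
  hence "a = 0" "b = 0" by auto
  moreover have "ket2 (site 0) (site 0) = bas (0, 0)"
    unfolding site_0 by (simp only: ket_label[OF zero_label] tens_bas)
  ultimately show ?case using vac by simp
next
  case (Suc l)
  have step: "ket2 (site (a + 1)) (site b) \<in> N \<and> ket2 (site a) (site (b + 1)) \<in> N"
    if ab: "a \<ge> 0" "b \<ge> 0" "nat (a + b) = l" for a b
  proof -
    let ?u = "ket2 (site (a + 1)) (site b)" and ?w = "ket2 (site a) (site (b + 1))"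
    have k: "ket2 (site a) (site b) \<in> N" using Suc.hyps(1)[of a b] ab by simp
    have fn: "fcoef n z n m = 1" for z m using n_ge by (simp add: fcoef_def)
    have s: "site c - sh n = site (c + 1)" for c unfolding sh_n by (auto simp: site_def)
    have L: "site a \<in> L" "site b \<in> L" using ab by simp_all
    have "\<rho> (gf n) (ket2 (site a) (site b)) = smul 1 ?u + smul (inverse (ppar * qpar powi (- a))) ?w"
      unfolding rho_f_ket2[OF order_refl L] fn s kval_site mult_1_right by (rule refl)
    hence f: "smul 1 ?u + smul (inverse (ppar * qpar powi (- a))) ?w \<in> N"
      using submodD(5)[OF N ge_gf_carrier(2)[OF order_refl] k] by simp
    have r: "smul (xvar * inverse ppar * qpar powi b) ?u + smul yvar ?w \<in> N"
      using submodD(5)[OF N words_carrier(2) k] unfolding rho_raise_word[OF ab(1,2)] .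
    \<comment> \<open>Eliminating the first vector from the two combinations leaves the determinant.\<close>
    define \<alpha> \<beta> where "\<alpha> = xvar * inverse ppar * qpar powi b" and "\<beta> = inverse (ppar * qpar powi (- a))"
    have "(smul \<alpha> ?u + smul yvar ?w) + - smul \<alpha> (smul 1 ?u + smul \<beta> ?w) \<in> N"
      using r f submodD[OF N] unfolding \<alpha>_def \<beta>_def by blast
    moreover have "(smul \<alpha> ?u + smul yvar ?w) + - smul \<alpha> (smul 1 ?u + smul \<beta> ?w)
        = smul (yvar - \<alpha> * \<beta>) ?w + smul 0 0"
      by (simp add: algebra_simps del: smul_single ket_label ket_nonlabel)
    ultimately have w': "smul (yvar - \<alpha> * \<beta>) ?w + smul 0 0 \<in> N" by simp
    have "\<alpha> * \<beta> = xvar * (inverse ppar * inverse ppar) * (qpar powi a * qpar powi b)"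
      by (simp add: \<alpha>_def \<beta>_def power_int_minus mult_ac)
    also have "inverse ppar * inverse ppar = - qpar"
      using ppar_square by (simp flip: inverse_mult_distrib)
    also have "qpar powi a * qpar powi b = qpar ^ nat (a + b)"
      using ab power_int_add[of qpar a b] by (simp add: power_int_def)
    finally have "yvar - \<alpha> * \<beta> = yvar + xvar * qpar ^ Suc (nat (a + b))" by simp
    hence "yvar - \<alpha> * \<beta> \<noteq> 0" using xy_generic(2) by metis
    from submod_cancel[OF N w' submodD(2)[OF N] this] have w: "?w \<in> N" .
    moreover have "?u \<in> N" by (rule submod_cancel[OF N f w]) simp
    ultimately show ?thesis by blast
  qed
  show ?case
  proof (cases "a \<ge> 1")
    case True
    thus ?thesis using step[of "a - 1" b] Suc by simp
  next
    case False
    thus ?thesis using step[of a "b - 1"] Suc by simp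
  qed
qed

text \<open>
  Induction on the total height and, within it, on the height of the left label. Applying \<open>f_i\<close> to
  \<open>(m + sh i, m')\<close>, which has smaller total height, gives a combination of \<open>(m, m')\<close> and
  \<open>(m + sh i, m' - sh i)\<close>; the latter has a lower left label. This ends with an
  empty left factor, which \<open>f_i\<close> kills for \<open>i < n\<close>; then \<open>f_i\<close> builds up the right factor, starting
  from the labels concentrated at site \<open>n\<close>.
\<close>
lemma all_in_submodule:
  assumes N: "submod N" and vac: "bas (0, 0) \<in> N"
  shows "m \<in> L \<Longrightarrow> m' \<in> L \<Longrightarrow> ket2 m m' \<in> N"
proof (induction "nat (height m + height m')" arbitrary: m m' rule: less_induct)
  case outer: less
  from outer.prems outer.hyps show ?case
  proof (induction "nat (height m)" arbitrary: m m' rule: less_induct)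
    case inner: less
    note L = inner.prems(1,2)
    have height_L: "0 \<le> height m" "0 \<le> height m'" using L by (simp_all add: height_nonneg)
    show ?case
    proof (cases "m = 0")
      case False
      with L obtain i where i: "1 \<le> i" "i \<le> n" "m + sh i \<in> L" "m i \<ge> 1"
        by (auto elim: exists_step_nonzero)
      have h: "height (m + sh i) = height m - 1" using i by (simp add: height_plus height_sh)
      have "0 \<le> height (m + sh i)" using i by (simp add: height_nonneg)
      have "ket2 (m + sh i) m' \<in> N"
        using inner.prems(3)[of "m + sh i" m'] i L h height_L \<open>0 \<le> height (m + sh i)\<close> by simp
      from submodD(5)[OF N ge_gf_carrier(2)[OF i(2)] this]
      have "smul (fcoef n xvar i (m + sh i)) (ket2 m m')
         + smul (inverse (kv i (m + sh i)) * fcoef n yvar i m') (ket2 (m + sh i) (m' - sh i)) \<in> N"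
        unfolding rho_f_ket2[OF i(2,3) L(2)] by simp
      moreover have "ket2 (m + sh i) (m' - sh i) \<in> N"
      proof (cases "m' - sh i \<in> L")
        case True
        have sum: "height (m + sh i) + height (m' - sh i) = height m + height m'"
          by (simp add: height_plus height_minus)
        show ?thesis
          by (rule inner.hyps) (use sum True i h \<open>0 \<le> height (m + sh i)\<close> inner.prems(3) in simp_all)
      qed (use submodD(2)[OF N] in simp)
      moreover have "fcoef n xvar i (m + sh i) \<noteq> 0"
      proof (cases "i < n")
        case True
        have "m (i + 1) \<ge> 0" using L by (simp add: L_iff)
        hence "(m + sh i) (i + 1) \<noteq> 0" using True by (simp add: shift_def)
        thus ?thesis using True i qnum_nonzero by (simp add: fcoef_def)
      qed (use i in \<open>simp add: fcoef_def\<close>)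
      ultimately show ?thesis by (rule submod_cancel[OF N])
    next
      case m: True
      show ?thesis
      proof (cases "m' = site (m' n)")
        case True
        have "m' n \<ge> 0" using L by (simp add: L_iff)
        thus ?thesis using last_site_in_submodule[OF N vac, of 0 "m' n"] m True by (metis site_0 order_refl)
      next
        case False
        then obtain l where l: "l < n" "m' l \<noteq> 0" using L by (auto simp: eq_site_iff)
        moreover have "\<kappa> \<le> n - 1" "n - 1 \<le> n" "l \<le> n - 1" using n_ge l by auto
        ultimately obtain i where i: "1 \<le> i" "i \<le> n - 1" "m' + sh i \<in> L" "m' i \<ge> 1"
          using L exists_step[of m' "n - 1" l] by blast
        have i_n: "i < n" "i \<le> n" using i n_ge by auto
        have h: "height (m' + sh i) = height m' - 1" using i i_n by (simp add: height_plus height_sh)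
        have "0 \<le> height (m' + sh i)" using i by (simp add: height_nonneg)
        have "ket2 m (m' + sh i) \<in> N"
          using inner.prems(3)[of m "m' + sh i"] i L h height_L \<open>0 \<le> height (m' + sh i)\<close> by simp
        from submodD(5)[OF N ge_gf_carrier(2)[OF i_n(2)] this]
        have "smul (fcoef n xvar i m) (ket2 (m - sh i) (m' + sh i))
           + smul (inverse (kv i m) * fcoef n yvar i (m' + sh i)) (ket2 m m') \<in> N"
          unfolding rho_f_ket2[OF i_n(2) L(1) i(3)] by simp
        moreover have "fcoef n xvar i m = 0" using i i_n m by (simp add: fcoef_def)
        ultimately have "smul (inverse (kv i m) * fcoef n yvar i (m' + sh i)) (ket2 m m') + smul 0 0 \<in> N"
          by (simp del: ket_label)
        moreover have "inverse (kv i m) * fcoef n yvar i (m' + sh i) \<noteq> 0"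
        proof -
          have "m' (i + 1) \<ge> 0" using L by (simp add: L_iff)
          hence "(m' + sh i) (i + 1) \<noteq> 0" using i_n by (simp add: shift_def)
          thus ?thesis using i i_n qnum_nonzero by (simp add: fcoef_def)
        qed
        ultimately show ?thesis using submod_cancel[OF N _ submodD(2)[OF N]] by blast
      qed
    qed
  qed
qed

lemma submodule_trivial:
  assumes N: "submod N"
  shows "N = {0} \<or> N = WW2"
proof (cases "N = {0}")
  case False
  then obtain v where v: "v \<in> N" "v \<noteq> 0" using submodD(2)[OF N] by auto
  define d where "d = Suc (Max ((\<lambda>(m, m'). nat (height m + height m')) ` Poly_Mapping.keys v))"
  have "height m + height m' < int d" if "(m, m') \<in> Poly_Mapping.keys v" for m m'
  proof -
    have "nat (height m + height m') \<le> Max ((\<lambda>(m, m'). nat (height m + height m')) ` Poly_Mapping.keys v)"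
      using that by (intro Max_ge) (auto intro!: image_eqI[of _ _ "(m, m')"])
    thus ?thesis by (simp add: d_def)
  qed
  from vacuum_in_submodule[OF N v this] have vac: "bas (0, 0) \<in> N" .
  have "w \<in> N" if "w \<in> WW2" for w
  proof -
    have summand: "smul (Poly_Mapping.lookup w k) (bas k) \<in> N" if "k \<in> Poly_Mapping.keys w" for k
    proof (cases k)
      case (Pair m m')
      hence L: "m \<in> L" "m' \<in> L" using WW2_keys[OF \<open>w \<in> WW2\<close>] that by auto
      thus ?thesis using all_in_submodule[OF N vac L] submodD(6)[OF N] Pair by (simp del: smul_single)
    qed
    have "(\<Sum>k\<in>K. smul (Poly_Mapping.lookup w k) (bas k)) \<in> N" if "finite K" "K \<subseteq> Poly_Mapping.keys w" for K
      using that by (induction K rule: finite_induct)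
        (auto intro: submodD(2,3)[OF N] summand simp del: smul_single)
    from this[OF finite_keys order_refl] show ?thesis by (simp only: bas_expansion[symmetric])
  qed
  thus ?thesis using submodD(1)[OF N] by auto
qed simp

lemma irreducible: "irreducible_module (UB n \<epsilon>) WW2 (WW_action \<kappa> \<kappa>')"
proof -
  have "bas (0, 0) \<in> WW2" by (simp add: WW_def)
  moreover have "bas (0, 0) \<noteq> (0 :: label \<times> label \<Rightarrow>\<^sub>0 scalar)"
    by (metis lookup_single_eq lookup_zero zero_neq_one)
  ultimately have "WW2 \<noteq> {0}" by blast
  thus ?thesis
    using WW_left_module submodule_trivial unfolding irreducible_module_def submod_def by blast
qed

end

theorem proposition7p7:
  fixes \<kappa> \<kappa>' n :: nat
  assumes "\<kappa> \<ge> 1" and "\<kappa>' \<ge> 1" and "n = \<kappa> + \<kappa>'"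
  shows "irreducible_module (UB n (eps \<kappa>)) (WW \<kappa> \<kappa>') (WW_action \<kappa> \<kappa>')"
proof -
  interpret chain \<kappa> \<kappa>' n
    using assms by unfold_locales
  show ?thesis by (rule irreducible)
qed

end
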